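(* Quantum auxiliary-input EFI pairs exist. That is, there exists a family $\{\xi_{\lambda,b}\}_{\lambda\in\mathbb{N},b\in\{0,1\}}$ of (mixed) quantum states such that: (i) for each $b\in\{0,1\}$, $\xi_{\lambda,b}$ is a $\mathrm{poly}(\lambda)$-qubit state; (ii) $\mathrm{TD}(\xi_{\lambda,0},\xi_{\lambda,1})=1-\mathsf{negl}(\lambda)$; (iii) for every non-uniform QPT distinguisher $\{\mathcal{A}_\lambda,\rho_\lambda\}_{\lambda\in\mathbb{N}}$, $$\left|\Pr[\mathcal{A}_\lambda(\rho_\lambda,\xi_{\lambda,0})=1]-\Pr[\mathcal{A}_\lambda(\rho_\lambda,\xi_{\lambda,1})=1]\right|=\mathsf{negl}(\lambda).$$
   Context: $\mathrm{TD}(\rho,\sigma)=\frac12\|\rho-\sigma\|_1$ is the trace distance. A non-uniform QPT algorithm $\{\mathcal{A}_\lambda,\rho_\lambda\}_{\lambda}$ consists of a $\mathrm{poly}(\lambda)$-size quantum circuit $\mathcal{A}_\lambda$ and an arbitrary $\mathrm{poly}(\lambda)$-qubit quantum advice state $\rho_\lambda$. The states $\xi_{\lambda,b}$ are not required to be efficiently generatable. *)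

theory Defs
  imports "Jordan_Normal_Form.Char_Poly"
begin

definition mtrace :: "complex mat \<Rightarrow> complex" where
  "mtrace A = (\<Sum>i<dim_row A. A $$ (i, i))"

definition adj :: "complex mat \<Rightarrow> complex mat" where
  "adj A = mat (dim_col A) (dim_row A) (\<lambda>(i, j). cnj (A $$ (j, i)))"

text \<open>Kronecker (tensor) product; basis index of the left factor is the more significant one.\<close>
definition kron :: "complex mat \<Rightarrow> complex mat \<Rightarrow> complex mat" where
  "kron A B = mat (dim_row A * dim_row B) (dim_col A * dim_col B)
     (\<lambda>(i, j). A $$ (i div dim_row B, j div dim_col B) * B $$ (i mod dim_row B, j mod dim_col B))"

definition unitary :: "complex mat \<Rightarrow> bool" where
  "unitary U \<longleftrightarrow> square_mat U \<and> U * adj U = 1\<^sub>m (dim_row U) \<and> adj U * U = 1\<^sub>m (dim_row U)"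

definition density :: "nat \<Rightarrow> complex mat \<Rightarrow> bool" where
  "density n \<rho> \<longleftrightarrow> \<rho> \<in> carrier_mat (2 ^ n) (2 ^ n) \<and> adj \<rho> = \<rho> \<and>
     (\<forall>v \<in> carrier_vec (2 ^ n). 0 \<le> Re (conjugate v \<bullet> (\<rho> *\<^sub>v v))) \<and> mtrace \<rho> = 1"

text \<open>Trace norm of a Hermitian matrix: sum of absolute values of eigenvalues counted with
  (algebraic = geometric, for Hermitian matrices) multiplicity, i.e. the sum of singular values.\<close>
definition trace_norm_herm :: "complex mat \<Rightarrow> real" where
  "trace_norm_herm A =
     (\<Sum>z \<in> {z. poly (char_poly A) z = 0}. real (order z (char_poly A)) * cmod z)"

definition TD :: "complex mat \<Rightarrow> complex mat \<Rightarrow> real" where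
  "TD \<rho> \<sigma> = trace_norm_herm (\<rho> - \<sigma>) / 2"

datatype gate = Hg nat | Tg nat | CNOTg nat nat

definition H1 :: "complex mat" where
  "H1 = mat 2 2 (\<lambda>(i, j). if i = 1 \<and> j = 1 then - 1 / complex_of_real (sqrt 2)
                          else 1 / complex_of_real (sqrt 2))"

definition T1 :: "complex mat" where
  "T1 = mat 2 2 (\<lambda>(i, j). if i \<noteq> j then 0 else if i = 0 then 1 else cis (pi / 4))"

text \<open>Value of qubit q (qubit 0 is the most significant) of basis index j on n qubits.\<close>
definition qbit :: "nat \<Rightarrow> nat \<Rightarrow> nat \<Rightarrow> nat" where
  "qbit n q j = (j div 2 ^ (n - 1 - q)) mod 2"

definition single_gate :: "nat \<Rightarrow> nat \<Rightarrow> complex mat \<Rightarrow> complex mat" where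
  "single_gate n q G = kron (1\<^sub>m (2 ^ q)) (kron G (1\<^sub>m (2 ^ (n - q - 1))))"

definition cnot_perm :: "nat \<Rightarrow> nat \<Rightarrow> nat \<Rightarrow> nat \<Rightarrow> nat" where
  "cnot_perm n c t j = (if qbit n c j = 1
     then (if qbit n t j = 1 then j - 2 ^ (n - 1 - t) else j + 2 ^ (n - 1 - t)) else j)"

fun gate_mat :: "nat \<Rightarrow> gate \<Rightarrow> complex mat" where
  "gate_mat n (Hg q) = single_gate n q H1"
| "gate_mat n (Tg q) = single_gate n q T1"
| "gate_mat n (CNOTg c t) =
     mat (2 ^ n) (2 ^ n) (\<lambda>(i, j). if i = cnot_perm n c t j then 1 else 0)"

fun gate_wf :: "nat \<Rightarrow> gate \<Rightarrow> bool" where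
  "gate_wf n (Hg q) = (q < n)"
| "gate_wf n (Tg q) = (q < n)"
| "gate_wf n (CNOTg c t) = (c < n \<and> t < n \<and> c \<noteq> t)"

definition circuit_wf :: "nat \<Rightarrow> gate list \<Rightarrow> bool" where
  "circuit_wf n C \<longleftrightarrow> (\<forall>g \<in> set C. gate_wf n g)"

fun circuit_mat :: "nat \<Rightarrow> gate list \<Rightarrow> complex mat" where
  "circuit_mat n [] = 1\<^sub>m (2 ^ n)"
| "circuit_mat n (g # C) = circuit_mat n C * gate_mat n g"

definition ket0_proj :: "nat \<Rightarrow> complex mat" where
  "ket0_proj k = mat (2 ^ k) (2 ^ k) (\<lambda>(i, j). if i = 0 \<and> j = 0 then 1 else 0)"

definition proj1 :: "complex mat" where
  "proj1 = mat 2 2 (\<lambda>(i, j). if i = 1 \<and> j = 1 then 1 else 0)"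

text \<open>Probability that circuit C on N = m + n + a qubits, run on advice \<rho> (m qubits),
  challenge \<xi> (n qubits) and a ancillas in state |0>, outputs 1 when the first qubit is
  measured in the computational basis.\<close>
definition accept_prob ::
  "gate list \<Rightarrow> nat \<Rightarrow> complex mat \<Rightarrow> nat \<Rightarrow> complex mat \<Rightarrow> nat \<Rightarrow> real" where
  "accept_prob C m \<rho> n \<xi> a =
     (let N = m + n + a; U = circuit_mat N C;
          \<sigma> = kron \<rho> (kron \<xi> (ket0_proj a))
      in Re (mtrace (kron proj1 (1\<^sub>m (2 ^ (N - 1))) * (U * \<sigma> * adj U))))"

definition poly_bounded :: "(nat \<Rightarrow> nat) \<Rightarrow> bool" where
  "poly_bounded p \<longleftrightarrow> (\<exists>c k::nat. \<forall>l. p l \<le> c * l ^ k + c)"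

definition negl :: "(nat \<Rightarrow> real) \<Rightarrow> bool" where
  "negl f \<longleftrightarrow> (\<forall>c::nat. eventually (\<lambda>l. \<bar>f l\<bar> \<le> 1 / real l ^ c) sequentially)"

end

theory Submission
  imports Defs "HOL-Library.FuncSet"
begin

text \<open>The challenge states are diagonal on \<open>l + 1\<close> qubits. Pair the basis states as \<open>2y, 2y + 1\<close>;
  a choice of signs \<open>\<epsilon> y\<close> for \<open>y < 2 ^ l\<close> decides which element of each pair lies in the support
  of the first state, the other one going to the second, so the supports are disjoint and the
  trace distance is exactly 1. For a fixed circuit the advantage with advice \<open>\<rho>\<close> is \<open>2 / 2 ^ l\<close> times
  the expectation in \<open>\<rho>\<close> of \<open>S = (\<Sum>y. \<epsilon> y * D y)\<close>, where the \<open>D y\<close> are Hermitian contractions on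
  the advice register. Uniformly in \<open>\<rho>\<close>, the \<open>q\<close>-th power of this expectation is at most
  \<open>4 ^ m * tr (S ^ q)\<close> when \<open>q\<close> is a power of two. Expanding \<open>S ^ q\<close> into words, every word has a
  non-negative average sign and a product of contractions has trace at most \<open>2 ^ m\<close>, so the average
  of \<open>tr (S ^ q)\<close> over the signs is at most \<open>2 ^ m\<close> times the \<open>q\<close>-th moment of a sum of independent
  signs. With \<open>q\<close> of order \<open>s\<^sup>2\<close> this beats the number of circuits of size \<open>s = 2 ^ (l div 12)\<close>,
  hence some choice of signs works against all of them and against all advice states.\<close>

subsection \<open>Adjoints, Kronecker products and contractions\<close>

lemma adj_dim [simp]: "dim_row (adj A) = dim_col A" "dim_col (adj A) = dim_row A"
  by (simp_all add: adj_def)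

lemma adj_carrier [simp]: "A \<in> carrier_mat r c \<Longrightarrow> adj A \<in> carrier_mat c r"
  by (auto simp: adj_def)

lemma adj_index [simp]:
  "i < dim_col A \<Longrightarrow> j < dim_row A \<Longrightarrow> adj A $$ (i, j) = cnj (A $$ (j, i))"
  by (simp add: adj_def)

lemma adj_adj [simp]: "adj (adj A) = A"
  by (rule eq_matI) auto

lemma mult_mat_index_sum:
  assumes "A \<in> carrier_mat r n" "B \<in> carrier_mat n c" "i < r" "j < c"
  shows "(A * B) $$ (i, j) = (\<Sum>k<n. A $$ (i, k) * B $$ (k, j))"
  using assms by (auto simp: scalar_prod_def atLeast0LessThan)

lemma mult_mat_vec_index_sum:
  assumes "A \<in> carrier_mat r n" "v \<in> carrier_vec n" "i < r"
  shows "(A *\<^sub>v v) $ i = (\<Sum>k<n. A $$ (i, k) * v $ k)"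
  using assms by (auto simp: scalar_prod_def atLeast0LessThan)

lemma adj_mult:
  assumes "A \<in> carrier_mat r n" "B \<in> carrier_mat n c"
  shows "adj (A * B) = adj B * adj A"
proof (rule eq_matI)
  fix i j assume ij: "i < dim_row (adj B * adj A)" "j < dim_col (adj B * adj A)"
  then have i: "i < c" and j: "j < r" using assms by auto
  have "adj (A * B) $$ (i, j) = cnj (\<Sum>k<n. A $$ (j, k) * B $$ (k, i))"
    using i j assms mult_mat_index_sum[OF assms j i] by auto
  also have "\<dots> = (\<Sum>k<n. adj B $$ (i, k) * adj A $$ (k, j))"
    using i j assms by (auto intro!: sum.cong simp: mult.commute)
  also have "\<dots> = (adj B * adj A) $$ (i, j)"
    using mult_mat_index_sum[of "adj B" c n "adj A" r i j] i j assms by simp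
  finally show "adj (A * B) $$ (i, j) = (adj B * adj A) $$ (i, j)" .
qed (use assms in auto)

text \<open>Row-major splitting of an index. This turns a sum over a tensor product register into an
  iterated sum over its factors, matching the index convention of \<open>kron\<close>.\<close>

lemma sum_div_mod:
  "(\<Sum>k<a * b. f k) = (\<Sum>i<a. \<Sum>j<b. f (i * b + j :: nat))"
proof -
  have "sum f {i * b..<i * b + b} = (\<Sum>j<b. f (i * b + j))" for i
    using sum.shift_bounds_nat_ivl[of f 0 "i * b" b]
    by (simp add: atLeast0LessThan add.commute)
  then show ?thesis
    using sum.nat_group[of f b a] by simp
qed

lemma kron_dim [simp]:
  "dim_row (kron A B) = dim_row A * dim_row B" "dim_col (kron A B) = dim_col A * dim_col B"
  by (simp_all add: kron_def)

lemma kron_carrier [simp]: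
  "A \<in> carrier_mat r c \<Longrightarrow> B \<in> carrier_mat r' c' \<Longrightarrow> kron A B \<in> carrier_mat (r * r') (c * c')"
  by (auto simp: kron_def)

lemma kron_index:
  "i < dim_row A * dim_row B \<Longrightarrow> j < dim_col A * dim_col B \<Longrightarrow> kron A B $$ (i, j) =
    A $$ (i div dim_row B, j div dim_col B) * B $$ (i mod dim_row B, j mod dim_col B)"
  by (simp add: kron_def)

lemma mult_add_less: "i * b + j < a * b" if "i < a" "j < (b::nat)"
proof -
  have "i * b + j < (i + 1) * b" using that by simp
  also have "\<dots> \<le> a * b" using that by (intro mult_le_mono1) auto
  finally show ?thesis .
qed

lemma div_mod_less: "i div b < a" "i mod b < b" if "i < a * (b::nat)"
  using that by (metis less_mult_imp_div_less, metis mod_less_divisor mult_0_right gr_zeroI not_less0)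

lemma kron_index_split:
  assumes "A \<in> carrier_mat ra ca" "B \<in> carrier_mat rb cb" "i < ra" "i' < rb" "j < ca" "j' < cb"
  shows "kron A B $$ (i * rb + i', j * cb + j') = A $$ (i, j) * B $$ (i', j')"
  using assms mult_add_less[of i ra i' rb] mult_add_less[of j ca j' cb]
  by (subst kron_index) auto

lemma kron_mult:
  assumes "A \<in> carrier_mat r n" "C \<in> carrier_mat n c" "B \<in> carrier_mat r' n'" "D \<in> carrier_mat n' c'"
  shows "kron A B * kron C D = kron (A * C) (B * D)"
proof (rule eq_matI)
  fix i j assume ij: "i < dim_row (kron (A * C) (B * D))" "j < dim_col (kron (A * C) (B * D))"
  then have i: "i < r * r'" and j: "j < c * c'" using assms by auto
  note id = div_mod_less[OF i] and jd = div_mod_less[OF j]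
  have "(kron A B * kron C D) $$ (i, j) = (\<Sum>k<n * n'. kron A B $$ (i, k) * kron C D $$ (k, j))"
    by (rule mult_mat_index_sum[OF kron_carrier kron_carrier]) (use assms i j in auto)
  also have "\<dots> = (\<Sum>k<n. \<Sum>k'<n'. (A $$ (i div r', k) * B $$ (i mod r', k')) *
      (C $$ (k, j div c') * D $$ (k', j mod c')))"
    unfolding sum_div_mod using assms i j
    by (intro sum.cong refl, subst (1 2) kron_index) (auto simp: mult_add_less)
  also have "\<dots> = (\<Sum>k<n. A $$ (i div r', k) * C $$ (k, j div c')) *
      (\<Sum>k'<n'. B $$ (i mod r', k') * D $$ (k', j mod c'))"
    unfolding sum_product by (simp add: mult_ac)
  also have "\<dots> = (A * C) $$ (i div r', j div c') * (B * D) $$ (i mod r', j mod c')"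
    using id jd by (simp only: mult_mat_index_sum[OF assms(1,2)] mult_mat_index_sum[OF assms(3,4)])
  also have "\<dots> = kron (A * C) (B * D) $$ (i, j)"
    using i j assms by (subst kron_index) auto
  finally show "(kron A B * kron C D) $$ (i, j) = kron (A * C) (B * D) $$ (i, j)" .
qed (use assms in auto)

lemma adj_kron: "adj (kron A B) = kron (adj A) (adj B)"
proof (rule eq_matI)
  fix i j assume "i < dim_row (kron (adj A) (adj B))" "j < dim_col (kron (adj A) (adj B))"
  then have i: "i < dim_col A * dim_col B" and j: "j < dim_row A * dim_row B" by auto
  show "adj (kron A B) $$ (i, j) = kron (adj A) (adj B) $$ (i, j)"
    using i j div_mod_less[OF i] div_mod_less[OF j] by (simp add: kron_index)
qed auto

lemma kron_one: "kron (1\<^sub>m a) (1\<^sub>m b) = 1\<^sub>m (a * b)"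
proof (rule eq_matI)
  fix i j assume "i < dim_row (1\<^sub>m (a * b) :: complex mat)" "j < dim_col (1\<^sub>m (a * b) :: complex mat)"
  then have i: "i < a * b" and j: "j < a * b" by auto
  have "i = j \<longleftrightarrow> i div b = j div b \<and> i mod b = j mod b"
    by (metis div_mult_mod_eq)
  then show "kron (1\<^sub>m a) (1\<^sub>m b) $$ (i, j) = 1\<^sub>m (a * b) $$ (i, j)"
    using i j div_mod_less[OF i] div_mod_less[OF j] by (auto simp: kron_index)
qed auto

lemma unitary_kron:
  assumes "unitary A" "unitary B"
  shows "unitary (kron A B)"
proof -
  obtain n m where A: "A \<in> carrier_mat n n" and B: "B \<in> carrier_mat m m"
    using assms by (auto simp: unitary_def)
  note A' = adj_carrier[OF A] and B' = adj_carrier[OF B]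
  have "A * adj A = 1\<^sub>m n" "adj A * A = 1\<^sub>m n" "B * adj B = 1\<^sub>m m" "adj B * B = 1\<^sub>m m"
    using assms A B by (auto simp: unitary_def)
  then show ?thesis
    unfolding unitary_def adj_kron kron_mult[OF A A' B B'] kron_mult[OF A' A B' B]
    using A B by (simp add: kron_one)
qed

lemma adj_one [simp]: "adj (1\<^sub>m n) = 1\<^sub>m n"
  by (rule eq_matI) auto

lemma unitary_one: "unitary (1\<^sub>m n)"
  by (simp add: unitary_def)

lemma unitary_adj: "unitary U \<Longrightarrow> unitary (adj U)"
  by (auto simp: unitary_def)

lemma unitary_mult:
  assumes U: "unitary U" "U \<in> carrier_mat n n" and V: "unitary V" "V \<in> carrier_mat n n"
  shows "unitary (U * V)"
proof -
  note U' = adj_carrier[OF U(2)] and V' = adj_carrier[OF V(2)]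
  have one: "U * adj U = 1\<^sub>m n" "adj U * U = 1\<^sub>m n" "V * adj V = 1\<^sub>m n" "adj V * V = 1\<^sub>m n"
    using U V by (auto simp: unitary_def)
  have "V * (adj V * adj U) = adj U"
    unfolding assoc_mult_mat[OF V(2) V' U', symmetric] one by (rule left_mult_one_mat[OF U'])
  then have "U * V * (adj V * adj U) = 1\<^sub>m n"
    unfolding assoc_mult_mat[OF U(2) V(2) mult_carrier_mat[OF V' U']] by (simp only: one)
  moreover have "adj U * (U * V) = V"
    unfolding assoc_mult_mat[OF U' U(2) V(2), symmetric] one by (rule left_mult_one_mat[OF V(2)])
  then have "adj V * adj U * (U * V) = 1\<^sub>m n"
    unfolding assoc_mult_mat[OF V' U' mult_carrier_mat[OF U(2) V(2)]] by (simp only: one)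
  moreover have "square_mat (U * V)" "dim_row (U * V) = n" using U V by auto
  ultimately show ?thesis
    unfolding unitary_def adj_mult[OF U(2) V(2)] by simp
qed

section \<open>Euclidean norms and contractions\<close>

definition nsq :: "complex vec \<Rightarrow> real" where
  "nsq v = (\<Sum>i<dim_vec v. (cmod (v $ i))\<^sup>2)"

text \<open>Operator norm at most 1, phrased through vectors so that closure under products,
  compressions and half-differences follows without spectral theory.\<close>

definition contraction :: "nat \<Rightarrow> complex mat \<Rightarrow> bool" where
  "contraction d A \<longleftrightarrow> A \<in> carrier_mat d d \<and> (\<forall>v \<in> carrier_vec d. nsq (A *\<^sub>v v) \<le> nsq v)"

lemma contraction_carrier: "contraction d A \<Longrightarrow> A \<in> carrier_mat d d"
  by (simp add: contraction_def)

lemma contraction_mult: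
  assumes "contraction d A" "contraction d B"
  shows "contraction d (A * B)"
  using assms unfolding contraction_def
  by (auto simp: assoc_mult_mat_vec[of A d d B d]) (meson mult_mat_vec_carrier order_trans)

lemma contraction_one: "contraction d (1\<^sub>m d)"
  by (auto simp: contraction_def)

lemma nsq_eq_sum: "v \<in> carrier_vec n \<Longrightarrow> complex_of_real (nsq v) = (\<Sum>i<n. cnj (v $ i) * v $ i)"
  by (auto simp: nsq_def complex_norm_square mult.commute simp del: of_real_power)

lemma contraction_unitary:
  assumes U: "unitary U" "U \<in> carrier_mat n n"
  shows "contraction n U"
proof -
  have "nsq (U *\<^sub>v v) = nsq v" if v: "v \<in> carrier_vec n" for v
  proof -
    have Uv: "U *\<^sub>v v \<in> carrier_vec n" using U v by auto
    have "complex_of_real (nsq (U *\<^sub>v v)) =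
        (\<Sum>i<n. cnj (\<Sum>j<n. U $$ (i, j) * v $ j) * (\<Sum>k<n. U $$ (i, k) * v $ k))"
      using nsq_eq_sum[OF Uv] by (simp add: mult_mat_vec_index_sum[OF U(2) v])
    also have "\<dots> = (\<Sum>i<n. \<Sum>j<n. \<Sum>k<n. cnj (v $ j) * v $ k * (cnj (U $$ (i, j)) * U $$ (i, k)))"
      unfolding cnj_sum sum_product by (simp add: mult_ac)
    also have "\<dots> = (\<Sum>j<n. \<Sum>i<n. \<Sum>k<n. cnj (v $ j) * v $ k * (cnj (U $$ (i, j)) * U $$ (i, k)))"
      by (rule sum.swap)
    also have "\<dots> = (\<Sum>j<n. \<Sum>k<n. \<Sum>i<n. cnj (v $ j) * v $ k * (cnj (U $$ (i, j)) * U $$ (i, k)))"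
      by (intro sum.cong refl sum.swap)
    also have "\<dots> = (\<Sum>j<n. \<Sum>k<n. cnj (v $ j) * v $ k * (adj U * U) $$ (j, k))"
      using U(2) by (intro sum.cong refl)
        (simp add: sum_distrib_left mult_mat_index_sum[OF adj_carrier[OF U(2)] U(2)] del: index_mult_mat)
    also have "\<dots> = (\<Sum>j<n. \<Sum>k<n. if j = k then cnj (v $ j) * v $ k else 0)"
      using U by (intro sum.cong refl) (auto simp: unitary_def)
    also have "\<dots> = complex_of_real (nsq v)"
      using nsq_eq_sum[OF v] by simp
    finally show ?thesis using of_real_eq_iff by blast
  qed
  then show ?thesis using U by (auto simp: contraction_def)
qed

text \<open>Compression to the coordinates in the image of \<open>h\<close>: pad the vector with
  zeros, apply \<open>A\<close>, and forget the other coordinates. Padding preserves the norm and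
  forgetting can only lower it.\<close>

lemma contraction_submatrix:
  assumes A: "contraction N A" and h: "inj_on h {..<d}" "h ` {..<d} \<subseteq> {..<N}"
  shows "contraction d (mat d d (\<lambda>(i, j). A $$ (h i, h j)))"
  unfolding contraction_def
proof (intro conjI ballI)
  let ?B = "mat d d (\<lambda>(i, j). A $$ (h i, h j))"
  fix v :: "complex vec" assume v: "v \<in> carrier_vec d"
  note Ac = contraction_carrier[OF A]
  define w where "w = vec N (\<lambda>k. if k \<in> h ` {..<d} then v $ (inv_into {..<d} h k) else 0)"
  have w: "w \<in> carrier_vec N" by (simp add: w_def)
  have wh: "w $ h j = v $ j" if "j < d" for j
    using that h by (auto simp: w_def)
  have w0: "w $ k = 0" if "k < N" "k \<notin> h ` {..<d}" for k
    using that by (auto simp: w_def)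
  have Bv: "(?B *\<^sub>v v) $ i = (A *\<^sub>v w) $ h i" if i: "i < d" for i
  proof -
    have hi: "h i < N" using h i by auto
    have "(A *\<^sub>v w) $ h i = (\<Sum>k<N. A $$ (h i, k) * w $ k)"
      using mult_mat_vec_index_sum[OF Ac w hi] .
    also have "\<dots> = (\<Sum>k\<in>h ` {..<d}. A $$ (h i, k) * w $ k)"
      using h w0 by (intro sum.mono_neutral_right) auto
    also have "\<dots> = (\<Sum>j<d. A $$ (h i, h j) * v $ j)"
      using h wh by (simp add: sum.reindex)
    also have "\<dots> = (?B *\<^sub>v v) $ i"
      using v i by (subst mult_mat_vec_index_sum[of _ d d]) auto
    finally show ?thesis by simp
  qed
  have "nsq (?B *\<^sub>v v) = (\<Sum>i<d. (cmod ((A *\<^sub>v w) $ h i))\<^sup>2)"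
    using Bv by (simp add: nsq_def)
  also have "\<dots> = (\<Sum>k\<in>h ` {..<d}. (cmod ((A *\<^sub>v w) $ k))\<^sup>2)"
    using h by (simp add: sum.reindex)
  also have "\<dots> \<le> nsq (A *\<^sub>v w)"
    unfolding nsq_def using h Ac by (intro sum_mono2) auto
  also have "\<dots> \<le> nsq w" using A w by (simp add: contraction_def)
  also have "\<dots> = (\<Sum>k\<in>h ` {..<d}. (cmod (w $ k))\<^sup>2)"
    unfolding nsq_def using h w w0 by (intro sum.mono_neutral_right) auto
  also have "\<dots> = nsq v"
    using h v wh by (simp add: sum.reindex nsq_def)
  finally show "nsq (?B *\<^sub>v v) \<le> nsq v" .
qed simp

lemma nsq_half_diff:
  assumes "v \<in> carrier_vec n" "w \<in> carrier_vec n"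
  shows "nsq (vec n (\<lambda>i. (v $ i - w $ i) / 2)) \<le> (nsq v + nsq w) / 2"
proof -
  have "(cmod ((a - b) / 2))\<^sup>2 \<le> ((cmod a)\<^sup>2 + (cmod b)\<^sup>2) / 2" for a b :: complex
  proof -
    have "cmod (a - b) \<le> cmod a + cmod b" by (rule norm_triangle_ineq4)
    then have "(cmod (a - b))\<^sup>2 \<le> (cmod a + cmod b)\<^sup>2" by (intro power_mono) auto
    also have "\<dots> \<le> 2 * ((cmod a)\<^sup>2 + (cmod b)\<^sup>2)"
      using zero_le_power2[of "cmod a - cmod b"] by (simp add: power2_eq_square algebra_simps)
    finally show ?thesis by (simp add: norm_divide power_divide)
  qed
  then have "(\<Sum>i<n. (cmod ((v $ i - w $ i) / 2))\<^sup>2) \<le> (\<Sum>i<n. ((cmod (v $ i))\<^sup>2 + (cmod (w $ i))\<^sup>2) / 2)"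
    by (intro sum_mono)
  then show ?thesis
    using assms by (simp add: nsq_def sum.distrib flip: sum_divide_distrib)
qed

lemma contraction_half_diff:
  assumes A: "contraction d A" and B: "contraction d B"
  shows "contraction d (mat d d (\<lambda>ij. (A $$ ij - B $$ ij) / 2))"
  unfolding contraction_def
proof (intro conjI ballI)
  let ?D = "mat d d (\<lambda>ij. (A $$ ij - B $$ ij) / 2)"
  fix v :: "complex vec" assume v: "v \<in> carrier_vec d"
  have "?D *\<^sub>v v = vec d (\<lambda>i. ((A *\<^sub>v v) $ i - (B *\<^sub>v v) $ i) / 2)"
    using contraction_carrier[OF A] contraction_carrier[OF B] v
    by (intro eq_vecI)
      (auto simp: scalar_prod_def sum_subtractf diff_divide_distrib left_diff_distrib
        sum_divide_distrib)
  moreover have "nsq (A *\<^sub>v v) \<le> nsq v" "nsq (B *\<^sub>v v) \<le> nsq v"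
    using A B v by (auto simp: contraction_def)
  ultimately show "nsq (?D *\<^sub>v v) \<le> nsq v"
    using nsq_half_diff[of "A *\<^sub>v v" d "B *\<^sub>v v"] contraction_carrier[OF A] contraction_carrier[OF B] v
    by auto
qed simp

text \<open>The entry is a coordinate of the image of a basis vector, which has norm at most 1.
  Applied to diagonal entries, it bounds the trace of a contraction by the dimension.\<close>

lemma contraction_entry_le:
  assumes A: "contraction d A" and ij: "i < d" "j < d"
  shows "cmod (A $$ (i, j)) \<le> 1"
proof -
  note Ac = contraction_carrier[OF A]
  have "(A *\<^sub>v unit_vec d j) $ i = A $$ (i, j)"
    using Ac ij by auto
  then have "(cmod (A $$ (i, j)))\<^sup>2 \<le> nsq (A *\<^sub>v unit_vec d j)"
    unfolding nsq_def using Ac ij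
    by (metis (no_types, lifting) carrier_matD(1) dim_mult_mat_vec finite_lessThan lessThan_iff
        member_le_sum zero_le_power2)
  also have "\<dots> \<le> nsq (unit_vec d j)" using A by (simp add: contraction_def)
  also have "\<dots> = (\<Sum>i<d. if i = j then 1 else 0)"
    unfolding nsq_def using ij by (intro sum.cong) auto
  also have "\<dots> = 1" using ij by simp
  finally show ?thesis by (simp add: power_le_one_iff abs_square_le_1)
qed

subsection \<open>Unitarity and counting of circuits\<close>

lemma unitary_H1: "unitary H1"
proof -
  have "complex_of_real (sqrt 2) * complex_of_real (sqrt 2) = 2"
    by (simp flip: of_real_mult)
  then have "H1 * H1 = 1\<^sub>m 2"
    by (intro eq_matI) (auto simp: H1_def scalar_prod_def numeral_2_eq_2 less_Suc_eq divide_simps)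
  moreover have "adj H1 = H1"
    by (rule eq_matI) (auto simp: H1_def)
  moreover have "H1 \<in> carrier_mat 2 2" by (simp add: H1_def)
  ultimately show ?thesis by (auto simp: unitary_def)
qed

lemma unitary_T1: "unitary T1"
proof -
  have "cis (pi / 4) * cnj (cis (pi / 4)) = 1"
    by (simp add: complex_mult_cnj flip: cis_cnj)
  then have "T1 * adj T1 = 1\<^sub>m 2" "adj T1 * T1 = 1\<^sub>m 2"
    by (intro eq_matI; auto simp: T1_def adj_def scalar_prod_def numeral_2_eq_2 less_Suc_eq mult.commute)+
  moreover have "T1 \<in> carrier_mat 2 2" by (simp add: T1_def)
  ultimately show ?thesis by (auto simp: unitary_def)
qed

lemma single_gate_carrier:
  assumes "q < n" "G \<in> carrier_mat 2 2"
  shows "single_gate n q G \<in> carrier_mat (2 ^ n) (2 ^ n)"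
proof -
  have "(2::nat) ^ q * (2 * 2 ^ (n - q - 1)) = 2 ^ n"
    using assms(1) by (simp flip: power_Suc power_add)
  moreover have "single_gate n q G \<in> carrier_mat (2 ^ q * (2 * 2 ^ (n - q - 1))) (2 ^ q * (2 * 2 ^ (n - q - 1)))"
    unfolding single_gate_def using assms(2) by (intro kron_carrier) auto
  ultimately show ?thesis by simp
qed

lemma unitary_single_gate: "unitary G \<Longrightarrow> unitary (single_gate n q G)"
  unfolding single_gate_def by (intro unitary_kron unitary_one)

section \<open>Bit flips and the CNOT permutation\<close>

lemma qbit_cases: "qbit n q j = 0 \<or> qbit n q j = 1"
  by (auto simp: qbit_def)

lemma qbit_decomp:
  obtains h r where "j = h * (2 * 2 ^ (n - 1 - q)) + qbit n q j * 2 ^ (n - 1 - q) + r" "r < 2 ^ (n - 1 - q)"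
proof
  let ?w = "(2::nat) ^ (n - 1 - q)"
  show "j mod ?w < ?w" by simp
  have "j = (j div ?w) * ?w + j mod ?w" by (simp only: div_mult_mod_eq)
  also have "j div ?w = j div ?w div 2 * 2 + qbit n q j" by (simp add: qbit_def)
  finally show "j = (j div ?w div 2) * (2 * ?w) + qbit n q j * ?w + j mod ?w"
    by (simp add: algebra_simps)
qed

lemma qbit_of_decomp:
  assumes "r < 2 ^ (n - 1 - q)" "b < 2"
  shows "qbit n q (h * (2 * 2 ^ (n - 1 - q)) + b * 2 ^ (n - 1 - q) + r) = b"
proof -
  let ?w = "(2::nat) ^ (n - 1 - q)"
  have "h * (2 * ?w) + b * ?w + r = (2 * h + b) * ?w + r" by (simp add: algebra_simps)
  moreover have "\<dots> div ?w = 2 * h + b" using assms(1) by simp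
  ultimately show ?thesis using assms(2) by (simp add: qbit_def)
qed

text \<open>The controlled branch of \<open>cnot_perm\<close>, isolated so that the flip can be
  shown to be an involution before the control enters.\<close>

definition flip_qbit :: "nat \<Rightarrow> nat \<Rightarrow> nat \<Rightarrow> nat" where
  "flip_qbit n t j = (if qbit n t j = 1 then j - 2 ^ (n - 1 - t) else j + 2 ^ (n - 1 - t))"

lemma flip_flip: "flip_qbit n t (flip_qbit n t j) = j"
proof -
  obtain h r where j: "j = h * (2 * 2 ^ (n - 1 - t)) + qbit n t j * 2 ^ (n - 1 - t) + r"
    and r: "r < 2 ^ (n - 1 - t)" by (rule qbit_decomp)
  let ?w = "(2::nat) ^ (n - 1 - t)"
  have *: "flip_qbit n t j = h * (2 * ?w) + (1 - qbit n t j) * ?w + r"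
    using qbit_cases[of n t j] j by (auto simp: flip_qbit_def)
  have 1: "qbit n t (flip_qbit n t j) = 1 - qbit n t j"
    unfolding * by (rule qbit_of_decomp[OF r]) simp
  show "flip_qbit n t (flip_qbit n t j) = j"
    using qbit_cases[of n t j] j 1 * by (auto simp: flip_qbit_def)
qed

text \<open>Only the bit of weight \<open>2 ^ (n - 1 - t)\<close> changes, so everything more
  significant survives. Two instances matter: the quotient that reads off a more significant
  control, and \<open>k = n\<close>, which keeps the index in range.\<close>

lemma flip_qbit_div:
  assumes "Suc (n - 1 - t) \<le> k"
  shows "flip_qbit n t j div 2 ^ k = j div 2 ^ k"
proof -
  obtain h r where j: "j = h * (2 * 2 ^ (n - 1 - t)) + qbit n t j * 2 ^ (n - 1 - t) + r"
    and r: "r < 2 ^ (n - 1 - t)" by (rule qbit_decomp)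
  let ?w = "(2::nat) ^ (n - 1 - t)"
  have *: "flip_qbit n t j = h * (2 * ?w) + (1 - qbit n t j) * ?w + r"
    using qbit_cases[of n t j] j by (auto simp: flip_qbit_def)
  have k: "(2::nat) ^ k = (2 * ?w) * 2 ^ (k - Suc (n - 1 - t))"
    using assms by (simp flip: power_Suc power_add)
  have d: "(h * (2 * ?w) + b * ?w + r) div (2 * ?w) = h" if "b < 2" for b
  proof -
    have "b * ?w + r < 2 * ?w" using that r by (auto simp: less_2_cases_iff)
    then show ?thesis by (simp add: add.assoc)
  qed
  have "qbit n t j < 2" "1 - qbit n t j < 2" using qbit_cases[of n t j] by auto
  then have "flip_qbit n t j div (2 * ?w) = h" "j div (2 * ?w) = h"
    using d * j by metis+
  then show ?thesis unfolding k div_mult2_eq by simp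
qed

lemma qbit_flip_other:
  assumes "c < n" "t < n" "c \<noteq> t"
  shows "qbit n c (flip_qbit n t j) = qbit n c j"
proof (cases "c < t")
  case True
  then have "Suc (n - 1 - t) \<le> n - 1 - c" using assms by auto
  from flip_qbit_div[OF this] show ?thesis by (simp add: qbit_def)
next
  case False
  let ?w = "(2::nat) ^ (n - 1 - t)" and ?v = "(2::nat) ^ (n - 1 - c)"
  have "Suc (n - 1 - c) + (n - 1 - t - Suc (n - 1 - c)) = n - 1 - t" using False assms by auto
  then have w: "?w = ?v * (2 * 2 ^ (n - 1 - t - Suc (n - 1 - c)))"
    by (metis power_Suc power_add mult.assoc mult.commute)
  \<comment> \<open>Here the control is less significant than the target, so \<open>?w\<close> is an
    even multiple of \<open>?v\<close>, and adding it does not change the parity of the quotient by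
    \<open>?v\<close>.\<close>
  have shift: "qbit n c (i + ?w) = qbit n c i" for i
    unfolding qbit_def w by simp
  show ?thesis
  proof (cases "qbit n t j = 1")
    case True
    then have "?w \<le> j"
      using qbit_decomp[of j n t] by (metis le_add1 le_add2 mult_1 order_trans)
    then show ?thesis using True shift[of "j - ?w"] by (simp add: flip_qbit_def)
  next
    case False
    then show ?thesis using shift[of j] by (simp add: flip_qbit_def)
  qed
qed

lemma cnot_perm_flip: "cnot_perm n c t j = (if qbit n c j = 1 then flip_qbit n t j else j)"
  by (simp add: cnot_perm_def flip_qbit_def)

lemma cnot_perm_involution:
  assumes "c < n" "t < n" "c \<noteq> t"
  shows "cnot_perm n c t (cnot_perm n c t j) = j"
  using qbit_flip_other[OF assms] by (simp add: cnot_perm_flip flip_flip)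

lemma cnot_perm_less:
  assumes "c < n" "t < n" "j < 2 ^ n"
  shows "cnot_perm n c t j < 2 ^ n"
proof -
  have "flip_qbit n t j div 2 ^ n = j div 2 ^ n"
    using assms by (intro flip_qbit_div) auto
  then have "flip_qbit n t j < 2 ^ n"
    using assms(3) by (metis div_eq_0_iff div_less power_not_zero zero_neq_numeral)
  then show ?thesis using assms by (simp add: cnot_perm_flip)
qed

text \<open>The permutation is an involution, so its matrix is real symmetric and is its own
  inverse.\<close>

lemma unitary_cnot:
  assumes wf: "c < n" "t < n" "c \<noteq> t"
  shows "unitary (gate_mat n (CNOTg c t))"
proof -
  let ?p = "cnot_perm n c t" and ?A = "gate_mat n (CNOTg c t)"
  have A: "?A \<in> carrier_mat (2 ^ n) (2 ^ n)" by simp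
  have sym: "i = ?p j \<longleftrightarrow> j = ?p i" for i j
    using cnot_perm_involution[OF wf] by metis
  have adjA: "adj ?A = ?A"
    using sym by (intro eq_matI) auto
  have "?A * ?A = 1\<^sub>m (2 ^ n)"
  proof (rule eq_matI)
    fix i j assume "i < dim_row (1\<^sub>m (2 ^ n) :: complex mat)" "j < dim_col (1\<^sub>m (2 ^ n) :: complex mat)"
    then have i: "i < 2 ^ n" and j: "j < 2 ^ n" by auto
    have "(?A * ?A) $$ (i, j) = (\<Sum>k<2 ^ n. ?A $$ (i, k) * ?A $$ (k, j))"
      by (rule mult_mat_index_sum[OF A A i j])
    also have "\<dots> = (\<Sum>k<2 ^ n. if k = ?p j then (if i = ?p k then 1 else 0) else 0)"
      using i j by (intro sum.cong) auto
    also have "\<dots> = (if i = ?p (?p j) then 1 else 0)"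
      using cnot_perm_less[OF wf(1,2) j] by simp
    also have "\<dots> = 1\<^sub>m (2 ^ n) $$ (i, j)"
      using i j cnot_perm_involution[OF wf] by simp
    finally show "(?A * ?A) $$ (i, j) = 1\<^sub>m (2 ^ n) $$ (i, j)" .
  qed auto
  then show ?thesis unfolding unitary_def adjA using A by auto
qed

lemma gate_mat_unitary:
  assumes "gate_wf n g"
  shows "gate_mat n g \<in> carrier_mat (2 ^ n) (2 ^ n) \<and> unitary (gate_mat n g)"
proof (cases g)
  case (Hg q)
  moreover have "H1 \<in> carrier_mat 2 2" by (simp add: H1_def)
  ultimately show ?thesis using assms single_gate_carrier unitary_single_gate unitary_H1 by simp
next
  case (Tg q)
  moreover have "T1 \<in> carrier_mat 2 2" by (simp add: T1_def)
  ultimately show ?thesis using assms single_gate_carrier unitary_single_gate unitary_T1 by simp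
next
  case (CNOTg c t)
  then show ?thesis using assms unitary_cnot[of c n t] by simp
qed

lemma circuit_mat_unitary:
  assumes "circuit_wf n C"
  shows "circuit_mat n C \<in> carrier_mat (2 ^ n) (2 ^ n) \<and> unitary (circuit_mat n C)"
  using assms
proof (induction C)
  case Nil
  then show ?case by (simp add: unitary_one)
next
  case (Cons g C)
  then have "gate_wf n g" "circuit_wf n C" by (auto simp: circuit_wf_def)
  then show ?case
    using Cons.IH gate_mat_unitary[of n g] by (auto intro!: unitary_mult)
qed

section \<open>Counting gates and circuits\<close>

lemma finite_gates: "finite {g. gate_wf K g}"
  and card_gates: "card {g. gate_wf K g} \<le> 4 ^ K"
proof -
  let ?S = "Hg ` {..<K} \<union> Tg ` {..<K} \<union> case_prod CNOTg ` ({..<K} \<times> {..<K})"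
  have sub: "{g. gate_wf K g} \<subseteq> ?S"
  proof
    fix g assume "g \<in> {g. gate_wf K g}"
    then show "g \<in> ?S" by (cases g) auto
  qed
  have fin: "finite ?S" by auto
  show "finite {g. gate_wf K g}" using sub fin by (rule finite_subset)
  have "card {g. gate_wf K g} \<le> card ?S" using sub fin by (rule card_mono[rotated])
  also have "\<dots> \<le> card (Hg ` {..<K}) + card (Tg ` {..<K}) + card (case_prod CNOTg ` ({..<K} \<times> {..<K}))"
    by (meson add_mono card_Un_le order_refl order_trans)
  also have "\<dots> \<le> K + K + K * K"
    by (intro add_mono order_trans[OF card_image_le]) auto
  \<comment> \<open>The quadratic count is rounded up to a power of 4, so that later counts only
    compare exponents.\<close>
  also have "\<dots> \<le> (K + 1) * (K + 1)" by simp
  also have "\<dots> \<le> 2 ^ K * 2 ^ K"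
    using Suc_leI[OF less_exp[of K]] by (intro mult_mono) (simp_all only: Suc_eq_plus1 zero_le)
  also have "\<dots> = 4 ^ K" by (simp flip: power_mult_distrib)
  finally show "card {g. gate_wf K g} \<le> 4 ^ K" .
qed

lemma finite_bounded_circuits: "finite {C. circuit_wf K C \<and> length C \<le> s}"
  and card_bounded_circuits: "card {C. circuit_wf K C \<and> length C \<le> s} \<le> (s + 1) * 4 ^ (K * s)"
proof -
  have e: "{C. circuit_wf K C \<and> length C \<le> s} = {C. set C \<subseteq> {g. gate_wf K g} \<and> length C \<le> s}"
    by (auto simp: circuit_wf_def)
  show "finite {C. circuit_wf K C \<and> length C \<le> s}"
    unfolding e by (rule finite_lists_length_le[OF finite_gates])
  have "card {C. circuit_wf K C \<and> length C \<le> s} = (\<Sum>i\<le>s. card {g. gate_wf K g} ^ i)"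
    unfolding e by (rule card_lists_length_le[OF finite_gates])
  also have "\<dots> \<le> (\<Sum>i\<le>s. 4 ^ (K * s))"
  proof (rule sum_mono)
    fix i assume "i \<in> {..s}"
    have "card {g. gate_wf K g} ^ i \<le> (4 ^ K) ^ i" by (intro power_mono card_gates) simp
    also have "\<dots> \<le> (4 ^ K) ^ s" using \<open>i \<in> {..s}\<close> by (intro power_increasing) auto
    finally show "card {g. gate_wf K g} ^ i \<le> 4 ^ (K * s)" by (simp add: power_mult)
  qed
  finally show "card {C. circuit_wf K C \<and> length C \<le> s} \<le> (s + 1) * 4 ^ (K * s)" by simp
qed

subsection \<open>Moments of a Hermitian matrix in a density matrix\<close>

lemma mtrace_mult:
  assumes "A \<in> carrier_mat r n" "B \<in> carrier_mat n r"
  shows "mtrace (A * B) = (\<Sum>i<r. \<Sum>k<n. A $$ (i, k) * B $$ (k, i))"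
proof -
  have "mtrace (A * B) = (\<Sum>i<r. (A * B) $$ (i, i))" using assms by (simp add: mtrace_def)
  also have "\<dots> = (\<Sum>i<r. \<Sum>k<n. A $$ (i, k) * B $$ (k, i))"
    by (intro sum.cong refl mult_mat_index_sum[OF assms]) auto
  finally show ?thesis .
qed

lemma mtrace_comm:
  assumes "A \<in> carrier_mat r n" "B \<in> carrier_mat n r"
  shows "mtrace (A * B) = mtrace (B * A)"
  unfolding mtrace_mult[OF assms] mtrace_mult[OF assms(2,1)]
  by (subst sum.swap) (simp add: mult.commute)

lemma pow_mat_add:
  assumes "A \<in> carrier_mat n n"
  shows "A ^\<^sub>m (k + l) = A ^\<^sub>m k * A ^\<^sub>m l"
proof (induction l)
  case 0
  have "A ^\<^sub>m k \<in> carrier_mat n n" using assms by (rule pow_carrier_mat)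
  then show ?case using assms by simp
next
  case (Suc l)
  have c: "A ^\<^sub>m m \<in> carrier_mat n n" for m using assms by (rule pow_carrier_mat)
  show ?case
    using Suc assoc_mult_mat[OF c[of k] c[of l] assms] by simp
qed

lemma pow_mat_Suc_left:
  assumes "A \<in> carrier_mat n n"
  shows "A ^\<^sub>m Suc k = A * A ^\<^sub>m k"
  using pow_mat_add[OF assms, of 1 k] assms by simp

lemma adj_pow_mat:
  assumes "A \<in> carrier_mat n n" "adj A = A"
  shows "adj (A ^\<^sub>m k) = A ^\<^sub>m k"
proof (induction k)
  case 0
  then show ?case using assms by simp
next
  case (Suc k)
  have "adj (A ^\<^sub>m Suc k) = A * A ^\<^sub>m k"
    using Suc assms adj_mult[OF pow_carrier_mat[OF assms(1), of k] assms(1)] by simp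
  then show ?case using pow_mat_Suc_left[OF assms(1)] by simp
qed

lemma hermitian_index: "adj A = A \<Longrightarrow> A \<in> carrier_mat n n \<Longrightarrow> i < n \<Longrightarrow> j < n \<Longrightarrow> A $$ (i, j) = cnj (A $$ (j, i))"
  by (metis adj_index carrier_matD)

section \<open>Entry and variance bounds for density matrices\<close>

lemma density_carrier: "density n \<rho> \<Longrightarrow> \<rho> \<in> carrier_mat (2 ^ n) (2 ^ n)"
  by (simp add: density_def)

lemma quad_form_sum:
  assumes "A \<in> carrier_mat d d"
  shows "conjugate (vec d v) \<bullet> (A *\<^sub>v vec d v) = (\<Sum>i<d. \<Sum>j<d. cnj (v i) * A $$ (i, j) * v j)"
proof -
  have "conjugate (vec d v) \<bullet> (A *\<^sub>v vec d v) = (\<Sum>i<d. cnj (v i) * (A *\<^sub>v vec d v) $ i)"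
    using assms unfolding scalar_prod_def by (auto simp: atLeast0LessThan conjugate_complex_def intro!: sum.cong)
  also have "\<dots> = (\<Sum>i<d. \<Sum>j<d. cnj (v i) * A $$ (i, j) * v j)"
    by (intro sum.cong refl, subst mult_mat_vec_index_sum[OF assms])
      (auto simp: sum_distrib_left mult.assoc)
  finally show ?thesis .
qed

lemma density_quad:
  assumes "density n \<rho>"
  shows "0 \<le> Re (\<Sum>i<2 ^ n. \<Sum>j<2 ^ n. cnj (v i) * \<rho> $$ (i, j) * v j)"
  using assms quad_form_sum[OF density_carrier[OF assms], of v] unfolding density_def
  by (metis vec_carrier)

lemma sum_indicator_pair:
  fixes d :: nat
  assumes "a < d" "b < d" "a \<noteq> b"
  shows "(\<Sum>i<d. if i = a then f i else if i = b then g i else (0::complex)) = f a + g b"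
proof -
  have "(\<Sum>i<d. if i = a then f i else if i = b then g i else 0) =
      (\<Sum>i<d. (if i = a then f i else 0) + (if i = b then g i else 0))"
    using assms by (intro sum.cong) auto
  also have "\<dots> = f a + g b" using assms by (simp add: sum.distrib)
  finally show ?thesis .
qed

lemma density_diag_nonneg:
  assumes "density n \<rho>" "a < 2 ^ n"
  shows "0 \<le> Re (\<rho> $$ (a, a))"
proof -
  let ?v = "\<lambda>i. if i = a then 1 else (0::complex)"
  have "(\<Sum>i<2 ^ n. \<Sum>j<2 ^ n. cnj (?v i) * \<rho> $$ (i, j) * ?v j) =
      (\<Sum>i<2 ^ n. \<Sum>j<2 ^ n. if j = a then (if i = a then \<rho> $$ (i, j) else 0) else 0)"
    by (intro sum.cong) auto
  also have "\<dots> = \<rho> $$ (a, a)" using assms by simp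
  finally show ?thesis using density_quad[OF assms(1), of ?v] by simp
qed

lemma density_diag_sum:
  assumes "density n \<rho>"
  shows "(\<Sum>i<2 ^ n. Re (\<rho> $$ (i, i))) = 1"
  using assms by (auto simp: density_def mtrace_def simp flip: Re_sum)

text \<open>Off the diagonal, positivity is tested on a vector supported on \<open>a\<close> and
  \<open>b\<close>. A suitable phase gives \<open>2 * cmod ?r \<le> Re (\<rho> $$ (a, a)) + Re
  (\<rho> $$ (b, b))\<close>, and the right side is at most the trace.\<close>

lemma density_entry_le:
  assumes \<rho>: "density n \<rho>" and ab: "a < 2 ^ n" "b < 2 ^ n"
  shows "cmod (\<rho> $$ (a, b)) \<le> 1"
proof (cases "a = b")
  case True
  have "\<rho> $$ (a, a) = cnj (\<rho> $$ (a, a))"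
    using \<rho> ab by (intro hermitian_index[of _ "2 ^ n"]) (auto simp: density_def)
  then have "Im (\<rho> $$ (a, a)) = 0" by (simp add: complex_eq_iff)
  then have "cmod (\<rho> $$ (a, a)) = Re (\<rho> $$ (a, a))"
    using density_diag_nonneg[OF \<rho> ab(1)] by (simp add: cmod_def)
  also have "\<dots> \<le> (\<Sum>i<2 ^ n. Re (\<rho> $$ (i, i)))"
    using ab density_diag_nonneg[OF \<rho>] by (intro member_le_sum) auto
  finally show ?thesis using density_diag_sum[OF \<rho>] True by simp
next
  case False
  let ?r = "\<rho> $$ (a, b)"
  show ?thesis
  proof (cases "?r = 0")
    case nz: False
    \<comment> \<open>The phase that makes \<open>z * ?r\<close> equal to \<open>- cmod ?r\<close>,
      so both cross terms of the quadratic form are as negative as possible.\<close>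
    define z where "z = - cnj ?r / cmod ?r"
    have "cmod z = 1" using nz by (simp add: z_def norm_divide)
    then have z1: "cnj z * z = 1"
      using complex_norm_square[of z] by (simp add: mult.commute)
    have "z * ?r = - (?r * cnj ?r) / cmod ?r" by (simp add: z_def)
    also have "\<dots> = - complex_of_real ((cmod ?r)\<^sup>2 / cmod ?r)"
      unfolding complex_norm_square[symmetric] by simp
    also have "(cmod ?r)\<^sup>2 / cmod ?r = cmod ?r" by (simp add: power2_eq_square)
    finally have zr: "z * ?r = - complex_of_real (cmod ?r)" .
    have ba: "\<rho> $$ (b, a) = cnj ?r"
      using \<rho> ab by (intro hermitian_index[of _ "2 ^ n"]) (auto simp: density_def)
    let ?v = "\<lambda>i. if i = a then 1 else if i = b then z else 0"
    have "(\<Sum>i<2 ^ n. \<Sum>j<2 ^ n. cnj (?v i) * \<rho> $$ (i, j) * ?v j) =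
      (\<Sum>i<2 ^ n. \<Sum>j<2 ^ n. if j = a then cnj (?v i) * \<rho> $$ (i, j)
         else if j = b then cnj (?v i) * \<rho> $$ (i, j) * z else 0)"
      by (intro sum.cong) auto
    also have "\<dots> = (\<Sum>i<2 ^ n. cnj (?v i) * \<rho> $$ (i, a) + cnj (?v i) * \<rho> $$ (i, b) * z)"
      using ab False by (intro sum.cong refl sum_indicator_pair)
    also have "\<dots> = (\<Sum>i<2 ^ n. if i = a then \<rho> $$ (i, a) + \<rho> $$ (i, b) * z
        else if i = b then cnj z * \<rho> $$ (i, a) + cnj z * \<rho> $$ (i, b) * z else 0)"
      by (intro sum.cong) auto
    also have "\<dots> = \<rho> $$ (a, a) + ?r * z + (cnj z * \<rho> $$ (b, a) + cnj z * \<rho> $$ (b, b) * z)"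
      by (rule sum_indicator_pair[OF ab False])
    also have "\<dots> = \<rho> $$ (a, a) + z * ?r + cnj (z * ?r) + \<rho> $$ (b, b) * (cnj z * z)"
      by (simp add: ba algebra_simps)
    also have "\<dots> = \<rho> $$ (a, a) + \<rho> $$ (b, b) - 2 * complex_of_real (cmod ?r)"
      unfolding z1 zr by simp
    finally have "2 * cmod ?r \<le> Re (\<rho> $$ (a, a)) + Re (\<rho> $$ (b, b))"
      using density_quad[OF \<rho>, of ?v] by simp
    also have "\<dots> = (\<Sum>i\<in>{a, b}. Re (\<rho> $$ (i, i)))" using False by simp
    also have "\<dots> \<le> (\<Sum>i<2 ^ n. Re (\<rho> $$ (i, i)))"
      using ab density_diag_nonneg[OF \<rho>] by (intro sum_mono2) auto
    finally show ?thesis using density_diag_sum[OF \<rho>] by simp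
  qed simp
qed

text \<open>By Hermiticity of \<open>X\<close> the trace is the sum, over the columns of
  \<open>X\<close>, of the quadratic form of \<open>\<rho>\<close> at that column.\<close>

lemma density_square_nonneg:
  assumes \<rho>: "density n \<rho>" and X: "X \<in> carrier_mat (2 ^ n) (2 ^ n)" "adj X = X"
  shows "0 \<le> Re (mtrace (\<rho> * (X * X)))"
proof -
  let ?d = "2 ^ n :: nat"
  have XX: "X * X \<in> carrier_mat ?d ?d" using X by auto
  have "mtrace (\<rho> * (X * X)) = (\<Sum>i<?d. \<Sum>k<?d. \<Sum>j<?d. \<rho> $$ (i, k) * (X $$ (k, j) * X $$ (j, i)))"
    unfolding mtrace_mult[OF density_carrier[OF \<rho>] XX]
    by (intro sum.cong refl, subst mult_mat_index_sum[OF X(1) X(1)]) (auto simp: sum_distrib_left)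
  also have "\<dots> = (\<Sum>i<?d. \<Sum>k<?d. \<Sum>j<?d. cnj (X $$ (i, j)) * \<rho> $$ (i, k) * X $$ (k, j))"
    by (intro sum.cong refl, subst (2) hermitian_index[OF X(2,1)]) (auto simp: mult_ac)
  also have "\<dots> = (\<Sum>i<?d. \<Sum>j<?d. \<Sum>k<?d. cnj (X $$ (i, j)) * \<rho> $$ (i, k) * X $$ (k, j))"
    by (intro sum.cong refl sum.swap)
  also have "\<dots> = (\<Sum>j<?d. \<Sum>i<?d. \<Sum>k<?d. cnj (X $$ (i, j)) * \<rho> $$ (i, k) * X $$ (k, j))"
    by (rule sum.swap)
  finally show ?thesis
    using density_quad[OF \<rho>] by (simp add: sum_nonneg)
qed

text \<open>Non-negativity of the variance of the observable \<open>X\<close> in the state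
  \<open>\<rho>\<close>.\<close>

lemma density_variance:
  assumes \<rho>: "density n \<rho>" and X: "X \<in> carrier_mat (2 ^ n) (2 ^ n)" "adj X = X"
  shows "(Re (mtrace (\<rho> * X)))\<^sup>2 \<le> Re (mtrace (\<rho> * (X * X)))"
proof -
  let ?d = "2 ^ n :: nat"
  define c where "c = Re (mtrace (\<rho> * X))"
  \<comment> \<open>The centred observable \<open>X - c\<close>, with \<open>c\<close> the
    expectation of \<open>X\<close>; the expectation of its square is the variance.\<close>
  define Y where "Y = mat ?d ?d (\<lambda>(i, j). X $$ (i, j) - (if i = j then complex_of_real c else 0))"
  have Y: "Y \<in> carrier_mat ?d ?d" by (simp add: Y_def)
  have "adj Y = Y"
    by (intro eq_matI) (auto simp: Y_def hermitian_index[OF X(2,1), symmetric])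
  have YY: "(Y * Y) $$ (k, i) = (X * X) $$ (k, i) - 2 * c * X $$ (k, i) + (if k = i then complex_of_real (c\<^sup>2) else 0)"
    if ki: "k < ?d" "i < ?d" for k i
  proof -
    have "(Y * Y) $$ (k, i) = (\<Sum>j<?d. Y $$ (k, j) * Y $$ (j, i))"
      by (rule mult_mat_index_sum[OF Y Y ki])
    also have "\<dots> = (\<Sum>j<?d. X $$ (k, j) * X $$ (j, i) - (if j = i then c * X $$ (k, j) else 0)
       - (if j = k then c * X $$ (j, i) else 0) + (if j = k then (if k = i then complex_of_real (c\<^sup>2) else 0) else 0))"
      using ki by (intro sum.cong) (auto simp: Y_def algebra_simps power2_eq_square)
    also have "\<dots> = (\<Sum>j<?d. X $$ (k, j) * X $$ (j, i)) - 2 * c * X $$ (k, i) + (if k = i then complex_of_real (c\<^sup>2) else 0)"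
      using ki by (simp add: sum.distrib sum_subtractf)
    finally show ?thesis using mult_mat_index_sum[OF X(1) X(1) ki] by simp
  qed
  have XXc: "X * X \<in> carrier_mat ?d ?d" and YYc: "Y * Y \<in> carrier_mat ?d ?d" using X Y by auto
  note \<rho>c = density_carrier[OF \<rho>]
  have "mtrace (\<rho> * (Y * Y)) = (\<Sum>i<?d. \<Sum>k<?d. \<rho> $$ (i, k) * (X * X) $$ (k, i) -
      2 * c * (\<rho> $$ (i, k) * X $$ (k, i)) + (if k = i then complex_of_real (c\<^sup>2) * \<rho> $$ (i, i) else 0))"
    unfolding mtrace_mult[OF \<rho>c YYc]
    by (intro sum.cong refl, subst YY) (auto simp: algebra_simps)
  also have "\<dots> = mtrace (\<rho> * (X * X)) - 2 * c * mtrace (\<rho> * X) + c\<^sup>2 * mtrace \<rho>"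
    unfolding mtrace_mult[OF \<rho>c XXc] mtrace_mult[OF \<rho>c X(1)]
    using \<rho>c by (simp add: sum.distrib sum_subtractf mtrace_def sum_distrib_left)
  finally have e: "mtrace (\<rho> * (Y * Y)) = mtrace (\<rho> * (X * X)) - 2 * c * mtrace (\<rho> * X) + c\<^sup>2"
    using \<rho> by (simp add: density_def)
  have "Re (mtrace (\<rho> * (Y * Y))) = Re (mtrace (\<rho> * (X * X))) - c\<^sup>2"
    unfolding e by (simp add: c_def power2_eq_square flip: of_real_mult)
  then show ?thesis
    using density_square_nonneg[OF \<rho> Y \<open>adj Y = Y\<close>] by (simp add: c_def)
qed

text \<open>Iterated variance inequality. Each application squares the observable, which is why the
  exponents are powers of two.\<close>

lemma density_moment:
  assumes \<rho>: "density n \<rho>" and X: "X \<in> carrier_mat (2 ^ n) (2 ^ n)" "adj X = X"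
  shows "\<bar>Re (mtrace (\<rho> * X))\<bar> ^ 2 ^ j \<le> \<bar>Re (mtrace (\<rho> * X ^\<^sub>m (2 ^ j)))\<bar>"
proof (induction j)
  case 0
  then show ?case using X by simp
next
  case (Suc j)
  let ?Y = "X ^\<^sub>m (2 ^ j)"
  have Y: "?Y \<in> carrier_mat (2 ^ n) (2 ^ n)" "adj ?Y = ?Y"
    using X pow_carrier_mat adj_pow_mat by blast+
  have "\<bar>Re (mtrace (\<rho> * X))\<bar> ^ 2 ^ Suc j = (\<bar>Re (mtrace (\<rho> * X))\<bar> ^ 2 ^ j)\<^sup>2"
    by (simp add: power_mult[symmetric] mult.commute)
  also have "\<dots> \<le> \<bar>Re (mtrace (\<rho> * ?Y))\<bar>\<^sup>2"
    using Suc by (intro power_mono) auto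
  also have "\<dots> \<le> Re (mtrace (\<rho> * (?Y * ?Y)))"
    using density_variance[OF \<rho> Y] by simp
  also have "?Y * ?Y = X ^\<^sub>m (2 ^ Suc j)"
    using pow_mat_add[OF X(1), of "2 ^ j" "2 ^ j"] by (simp add: mult_2)
  finally show ?case by simp
qed

lemma trace_square_hermitian:
  assumes Y: "Y \<in> carrier_mat d d" "adj Y = Y"
  shows "Re (mtrace (Y * Y)) = (\<Sum>i<d. \<Sum>j<d. (cmod (Y $$ (i, j)))\<^sup>2)"
proof -
  have "mtrace (Y * Y) = (\<Sum>i<d. \<Sum>j<d. complex_of_real ((cmod (Y $$ (i, j)))\<^sup>2))"
    unfolding mtrace_mult[OF Y(1,1)] complex_norm_square
    by (intro sum.cong refl, subst (2) hermitian_index[OF Y(2,1)]) auto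
  then show ?thesis by (simp only: Re_sum Re_complex_of_real)
qed

text \<open>Cauchy-Schwarz against the constant function 1, by the arithmetic-geometric mean on
  pairs.\<close>

lemma power2_sum_le:
  fixes f :: "'a \<Rightarrow> real"
  assumes "finite A"
  shows "(sum f A)\<^sup>2 \<le> (\<Sum>p\<in>A. (f p)\<^sup>2) * card A"
proof -
  have "(sum f A)\<^sup>2 = (\<Sum>p\<in>A. \<Sum>q\<in>A. f p * f q)"
    by (simp add: power2_eq_square sum_product)
  also have "\<dots> \<le> (\<Sum>p\<in>A. \<Sum>q\<in>A. ((f p)\<^sup>2 + (f q)\<^sup>2) / 2)"
    using sum_squares_bound by (intro sum_mono) (simp add: field_simps)
  also have "\<dots> = (\<Sum>p\<in>A. (f p)\<^sup>2) * card A"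
    by (simp add: sum.distrib flip: sum_divide_distrib sum_distrib_left)
  finally show ?thesis .
qed

text \<open>Entries of \<open>\<rho>\<close> have modulus at most 1, so the expectation is at most
  the sum of the moduli of the \<open>4 ^ n\<close> entries of \<open>Y\<close>. Cauchy-Schwarz then
  gives the squared Frobenius norm, which is \<open>mtrace (Y * Y)\<close> for Hermitian
  \<open>Y\<close>.\<close>

lemma density_trace_bound:
  assumes \<rho>: "density n \<rho>" and Y: "Y \<in> carrier_mat (2 ^ n) (2 ^ n)" "adj Y = Y"
  shows "(Re (mtrace (\<rho> * Y)))\<^sup>2 \<le> 4 ^ n * Re (mtrace (Y * Y))"
proof -
  let ?d = "2 ^ n :: nat"
  let ?y = "\<lambda>(i, j). cmod (Y $$ (i, j))"
  have "\<bar>Re (mtrace (\<rho> * Y))\<bar> \<le> cmod (mtrace (\<rho> * Y))" by (rule abs_Re_le_cmod)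
  also have "\<dots> \<le> (\<Sum>i<?d. \<Sum>k<?d. cmod (\<rho> $$ (i, k) * Y $$ (k, i)))"
    unfolding mtrace_mult[OF density_carrier[OF \<rho>] Y(1)]
    by (intro order_trans[OF norm_sum] sum_mono norm_sum)
  also have "\<dots> \<le> (\<Sum>i<?d. \<Sum>k<?d. cmod (Y $$ (k, i)))"
    using density_entry_le[OF \<rho>] by (intro sum_mono) (auto simp: norm_mult intro!: mult_left_le_one_le)
  also have "\<dots> = (\<Sum>k<?d. \<Sum>i<?d. cmod (Y $$ (k, i)))" by (rule sum.swap)
  also have "\<dots> = sum ?y ({..<?d} \<times> {..<?d})" by (simp add: sum.cartesian_product)
  finally have "\<bar>Re (mtrace (\<rho> * Y))\<bar>\<^sup>2 \<le> (sum ?y ({..<?d} \<times> {..<?d}))\<^sup>2"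
    by (intro power_mono) auto
  also have "\<dots> \<le> (\<Sum>p\<in>{..<?d} \<times> {..<?d}. (?y p)\<^sup>2) * card ({..<?d} \<times> {..<?d})"
    by (rule power2_sum_le) simp
  also have "(\<Sum>p\<in>{..<?d} \<times> {..<?d}. (?y p)\<^sup>2) = Re (mtrace (Y * Y))"
    unfolding trace_square_hermitian[OF Y] by (simp add: sum.cartesian_product case_prod_unfold)
  also have "real (card ({..<?d} \<times> {..<?d})) = 4 ^ n"
    by (simp add: card_cartesian_product flip: power_mult_distrib)
  finally show ?thesis by (simp add: mult.commute)
qed

text \<open>The last squaring uses \<open>density_trace_bound\<close> instead of the variance. This
  removes \<open>\<rho>\<close> from the right side, giving one bound for all advice states at the
  price of a dimension factor.\<close>

lemma density_moment_trace:
  assumes \<rho>: "density n \<rho>" and X: "X \<in> carrier_mat (2 ^ n) (2 ^ n)" "adj X = X"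
  shows "\<bar>Re (mtrace (\<rho> * X))\<bar> ^ 2 ^ Suc j \<le> 4 ^ n * Re (mtrace (X ^\<^sub>m (2 ^ Suc j)))"
proof -
  let ?Y = "X ^\<^sub>m (2 ^ j)"
  have Y: "?Y \<in> carrier_mat (2 ^ n) (2 ^ n)" "adj ?Y = ?Y"
    using X pow_carrier_mat adj_pow_mat by blast+
  have "\<bar>Re (mtrace (\<rho> * X))\<bar> ^ 2 ^ Suc j = (\<bar>Re (mtrace (\<rho> * X))\<bar> ^ 2 ^ j)\<^sup>2"
    by (simp add: power_mult[symmetric] mult.commute)
  also have "\<dots> \<le> \<bar>Re (mtrace (\<rho> * ?Y))\<bar>\<^sup>2"
    using density_moment[OF \<rho> X] by (intro power_mono) auto
  also have "\<dots> \<le> 4 ^ n * Re (mtrace (?Y * ?Y))"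
    using density_trace_bound[OF \<rho> Y] by simp
  also have "?Y * ?Y = X ^\<^sub>m (2 ^ Suc j)"
    using pow_mat_add[OF X(1), of "2 ^ j" "2 ^ j"] by (simp add: mult_2)
  finally show ?thesis .
qed

subsection \<open>Random signed sums of contractions\<close>

definition signed_sum :: "nat \<Rightarrow> nat \<Rightarrow> (nat \<Rightarrow> complex mat) \<Rightarrow> (nat \<Rightarrow> real) \<Rightarrow> complex mat" where
  "signed_sum d L D \<epsilon> = mat d d (\<lambda>ij. \<Sum>y<L. complex_of_real (\<epsilon> y) * D y $$ ij)"

definition words :: "nat \<Rightarrow> nat \<Rightarrow> nat list set" where
  "words L k = {w. set w \<subseteq> {..<L} \<and> length w = k}"

fun word_prod :: "nat \<Rightarrow> (nat \<Rightarrow> complex mat) \<Rightarrow> nat list \<Rightarrow> complex mat" where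
  "word_prod d D [] = 1\<^sub>m d"
| "word_prod d D (y # w) = D y * word_prod d D w"

lemma signed_sum_carrier [simp]: "signed_sum d L D \<epsilon> \<in> carrier_mat d d"
  by (simp add: signed_sum_def)

lemma adj_signed_sum:
  assumes "\<And>y. y < L \<Longrightarrow> D y \<in> carrier_mat d d" "\<And>y. y < L \<Longrightarrow> adj (D y) = D y"
  shows "adj (signed_sum d L D \<epsilon>) = signed_sum d L D \<epsilon>"
proof (rule eq_matI)
  fix i j assume "i < dim_row (signed_sum d L D \<epsilon>)" "j < dim_col (signed_sum d L D \<epsilon>)"
  then have ij: "i < d" "j < d" by (auto simp: signed_sum_def)
  then have "D y $$ (i, j) = cnj (D y $$ (j, i))" if "y < L" for y
    using that assms hermitian_index by blast
  then show "adj (signed_sum d L D \<epsilon>) $$ (i, j) = signed_sum d L D \<epsilon> $$ (i, j)"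
    using ij by (simp add: signed_sum_def)
qed (simp_all add: signed_sum_def)

lemma finite_words [simp]: "finite (words L k)"
  unfolding words_def by (rule finite_lists_length_eq) simp

lemma words_0: "words L 0 = {[]}"
  by (auto simp: words_def)

lemma sum_words_Suc: "(\<Sum>w\<in>words L (Suc k). f w) = (\<Sum>y<L. \<Sum>w\<in>words L k. f (y # w))"
proof -
  have "words L (Suc k) = (\<lambda>(y, w). y # w) ` ({..<L} \<times> words L k)"
    by (auto simp: words_def length_Suc_conv image_iff)
  moreover have "inj_on (\<lambda>(y, w). y # w) ({..<L} \<times> words L k)"
    by (auto simp: inj_on_def)
  ultimately have "(\<Sum>w\<in>words L (Suc k). f w) = (\<Sum>p\<in>{..<L} \<times> words L k. f (fst p # snd p))"
    by (simp add: sum.reindex case_prod_unfold)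
  also have "\<dots> = (\<Sum>y<L. \<Sum>w\<in>words L k. f (y # w))"
    by (simp add: sum.cartesian_product case_prod_unfold)
  finally show ?thesis .
qed

lemma word_prod_contraction:
  assumes "\<And>y. y < L \<Longrightarrow> contraction d (D y)" "set w \<subseteq> {..<L}"
  shows "contraction d (word_prod d D w)"
  using assms(2) by (induction w) (auto intro: contraction_one contraction_mult assms(1))

text \<open>Non-commutative multinomial expansion: words record the order of the factors, and the
  scalar signs separate from the matrix product.\<close>

lemma signed_sum_pow:
  assumes D: "\<And>y. y < L \<Longrightarrow> contraction d (D y)" and "i < d" "j < d"
  shows "(signed_sum d L D \<epsilon> ^\<^sub>m k) $$ (i, j) =
    (\<Sum>w\<in>words L k. complex_of_real (prod_list (map \<epsilon> w)) * word_prod d D w $$ (i, j))"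
  using assms(2)
proof (induction k arbitrary: i)
  case 0
  then show ?case using assms(3) by (simp add: words_0 signed_sum_def)
next
  case (Suc k)
  let ?S = "signed_sum d L D \<epsilon>" and ?e = "\<lambda>w. complex_of_real (prod_list (map \<epsilon> w))"
  have S: "?S \<in> carrier_mat d d" by simp
  have "(?S ^\<^sub>m Suc k) $$ (i, j) = (\<Sum>a<d. ?S $$ (i, a) * (?S ^\<^sub>m k) $$ (a, j))"
    unfolding pow_mat_Suc_left[OF S]
    by (rule mult_mat_index_sum[OF S pow_carrier_mat[OF S] Suc.prems assms(3)])
  also have "\<dots> = (\<Sum>a<d. (\<Sum>y<L. complex_of_real (\<epsilon> y) * D y $$ (i, a)) *
      (\<Sum>w\<in>words L k. ?e w * word_prod d D w $$ (a, j)))"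
    using Suc by (intro sum.cong refl) (simp add: signed_sum_def)
  also have "\<dots> = (\<Sum>a<d. \<Sum>y<L. \<Sum>w\<in>words L k. complex_of_real (\<epsilon> y) * D y $$ (i, a) *
      (?e w * word_prod d D w $$ (a, j)))"
    by (simp only: sum_product)
  also have "\<dots> = (\<Sum>y<L. \<Sum>a<d. \<Sum>w\<in>words L k. complex_of_real (\<epsilon> y) * D y $$ (i, a) *
      (?e w * word_prod d D w $$ (a, j)))"
    by (rule sum.swap)
  also have "\<dots> = (\<Sum>y<L. \<Sum>w\<in>words L k. \<Sum>a<d. complex_of_real (\<epsilon> y) * D y $$ (i, a) *
      (?e w * word_prod d D w $$ (a, j)))"
    by (intro sum.cong refl sum.swap)
  also have "\<dots> = (\<Sum>y<L. \<Sum>w\<in>words L k. ?e (y # w) * word_prod d D (y # w) $$ (i, j))"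
  proof (intro sum.cong refl)
    fix y w assume "y \<in> {..<L}" "w \<in> words L k"
    then have "D y \<in> carrier_mat d d" "word_prod d D w \<in> carrier_mat d d"
      using D word_prod_contraction[of L d D w] by (auto simp: words_def intro: contraction_carrier)
    from mult_mat_index_sum[OF this Suc.prems assms(3)]
    show "(\<Sum>a<d. complex_of_real (\<epsilon> y) * D y $$ (i, a) * (?e w * word_prod d D w $$ (a, j))) =
        ?e (y # w) * word_prod d D (y # w) $$ (i, j)"
      by (simp add: sum_distrib_left mult_ac del: index_mult_mat)
  qed
  finally show ?case unfolding sum_words_Suc .
qed

text \<open>The scalar case of the same expansion, to be compared with the matrix case word by
  word.\<close>

lemma sum_pow_words:
  fixes \<epsilon> :: "nat \<Rightarrow> real"
  shows "(\<Sum>y<L. \<epsilon> y) ^ k = (\<Sum>w\<in>words L k. prod_list (map \<epsilon> w))"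
proof (induction k)
  case 0
  then show ?case by (simp add: words_0)
next
  case (Suc k)
  then show ?case by (simp add: sum_words_Suc sum_product)
qed

section \<open>Averages over all choices of signs\<close>

definition signs :: "nat \<Rightarrow> (nat \<Rightarrow> real) set" where
  "signs L = PiE {..<L} (\<lambda>_. {- 1, 1})"

lemma finite_signs [simp]: "finite (signs L)"
  by (simp add: signs_def finite_PiE)

lemma card_signs: "card (signs L) = 2 ^ L"
  by (simp add: signs_def card_PiE numeral_2_eq_2)

text \<open>The scalar weight of a word depends only on letter multiplicities; in this form its sum
  over all signs factors over the letters.\<close>

lemma prod_list_map_count:
  fixes \<epsilon> :: "nat \<Rightarrow> real"
  assumes "set w \<subseteq> {..<L}"
  shows "prod_list (map \<epsilon> w) = (\<Prod>y<L. \<epsilon> y ^ count_list w y)"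
  using assms
proof (induction w)
  case (Cons a w)
  have "(\<Prod>y<L. \<epsilon> y ^ count_list (a # w) y) = (\<Prod>y<L. (if y = a then \<epsilon> y else 1) * \<epsilon> y ^ count_list w y)"
    by (intro prod.cong) auto
  also have "\<dots> = \<epsilon> a * (\<Prod>y<L. \<epsilon> y ^ count_list w y)"
    using Cons.prems by (simp add: prod.distrib)
  finally show ?case using Cons by simp
qed simp

text \<open>The sum factors over \<open>y\<close>, and each factor \<open>(- 1) ^ k + 1 ^ k\<close>
  is 0 or 2.\<close>

lemma sum_signs_word_nonneg:
  assumes "set w \<subseteq> {..<L}"
  shows "0 \<le> (\<Sum>\<epsilon>\<in>signs L. prod_list (map \<epsilon> w))"
proof -
  have "(\<Sum>\<epsilon>\<in>signs L. prod_list (map \<epsilon> w)) = (\<Sum>\<epsilon>\<in>signs L. \<Prod>y<L. \<epsilon> y ^ count_list w y)"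
    using prod_list_map_count[OF assms] by (intro sum.cong) auto
  also have "\<dots> = (\<Prod>y<L. \<Sum>e\<in>{- 1, 1}. e ^ count_list w y)"
    unfolding signs_def by (rule prod_sum_PiE[symmetric]) auto
  also have "\<dots> \<ge> 0"
    by (intro prod_nonneg) (auto simp: minus_one_power_iff)
  finally show ?thesis .
qed

text \<open>Every word has non-negative average sign, so replacing each product of the contractions by
  the identity can only increase the average trace of a power.\<close>
lemma sum_signs_trace_pow:
  assumes D: "\<And>y. y < L \<Longrightarrow> contraction d (D y)"
  shows "(\<Sum>\<epsilon>\<in>signs L. Re (mtrace (signed_sum d L D \<epsilon> ^\<^sub>m k))) \<le> d * (\<Sum>\<epsilon>\<in>signs L. (\<Sum>y<L. \<epsilon> y) ^ k)"
proof -
  let ?W = "word_prod d D"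
  let ?t = "\<lambda>w. \<Sum>i<d. Re (?W w $$ (i, i))"
  have tr: "Re (mtrace (signed_sum d L D \<epsilon> ^\<^sub>m k)) = (\<Sum>w\<in>words L k. prod_list (map \<epsilon> w) * ?t w)" for \<epsilon>
  proof -
    have "mtrace (signed_sum d L D \<epsilon> ^\<^sub>m k) =
        (\<Sum>i<d. \<Sum>w\<in>words L k. complex_of_real (prod_list (map \<epsilon> w)) * ?W w $$ (i, i))"
      using pow_carrier_mat[OF signed_sum_carrier, of d L D \<epsilon> k] carrier_matD(1)[OF signed_sum_carrier]
      by (auto simp: mtrace_def signed_sum_pow[OF D] intro!: sum.cong)
    then have "Re (mtrace (signed_sum d L D \<epsilon> ^\<^sub>m k)) =
        (\<Sum>i<d. \<Sum>w\<in>words L k. prod_list (map \<epsilon> w) * Re (?W w $$ (i, i)))"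
      by simp
    also have "\<dots> = (\<Sum>w\<in>words L k. \<Sum>i<d. prod_list (map \<epsilon> w) * Re (?W w $$ (i, i)))"
      by (rule sum.swap)
    finally show ?thesis by (simp add: sum_distrib_left)
  qed
  have t: "?t w \<le> d" if "w \<in> words L k" for w
  proof -
    have "contraction d (?W w)" using that D by (intro word_prod_contraction[of L]) (auto simp: words_def)
    then have "Re (?W w $$ (i, i)) \<le> 1" if "i < d" for i
      using contraction_entry_le[of d "?W w" i i] that complex_Re_le_cmod order_trans by blast
    then have "?t w \<le> (\<Sum>i<d. 1)" by (intro sum_mono) auto
    then show ?thesis by simp
  qed
  have "(\<Sum>\<epsilon>\<in>signs L. Re (mtrace (signed_sum d L D \<epsilon> ^\<^sub>m k))) =
      (\<Sum>w\<in>words L k. (\<Sum>\<epsilon>\<in>signs L. prod_list (map \<epsilon> w)) * ?t w)"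
    unfolding tr sum_distrib_right by (rule sum.swap)
  also have "\<dots> \<le> (\<Sum>w\<in>words L k. (\<Sum>\<epsilon>\<in>signs L. prod_list (map \<epsilon> w)) * d)"
    using t by (intro sum_mono mult_left_mono sum_signs_word_nonneg) (auto simp: words_def)
  also have "\<dots> = d * (\<Sum>\<epsilon>\<in>signs L. (\<Sum>y<L. \<epsilon> y) ^ k)"
    unfolding sum_pow_words sum_distrib_right[symmetric] by (subst sum.swap) (simp add: mult.commute)
  finally show ?thesis .
qed

section \<open>Scalar moments of a sum of independent signs\<close>

lemma power_le_fact_exp:
  fixes x :: real
  assumes "0 \<le> x"
  shows "x ^ k \<le> fact k * exp x"
proof -
  have "(\<Sum>n\<in>{k}. x ^ n /\<^sub>R fact n) \<le> (\<Sum>n. x ^ n /\<^sub>R fact n)"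
    using assms exp_converges[of x] by (intro sum_le_suminf) (auto simp: sums_iff)
  then have "x ^ k /\<^sub>R fact k \<le> exp x"
    using exp_converges[of x] by (simp add: sums_iff)
  then show ?thesis by (simp add: field_simps)
qed

lemma exp_sym_sum_le:
  fixes x :: real
  assumes "0 \<le> x" "x \<le> 1"
  shows "exp (- x) + exp x \<le> 2 * exp (x\<^sup>2)"
proof -
  have "exp x \<le> 1 + x + x\<^sup>2" using exp_bound assms by simp
  moreover have "exp (- x) \<le> 1 - x + x\<^sup>2"
  proof -
    \<comment> \<open>The product on the right is \<open>1 + x ^ 3\<close>; replacing
      \<open>1 + x\<close> by \<open>exp x\<close> then yields the bound on
      \<open>exp (- x)\<close>.\<close>
    have "1 \<le> (1 + x) * (1 - x + x\<^sup>2)"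
      using assms by (simp add: algebra_simps power2_eq_square)
    also have "\<dots> \<le> exp x * (1 - x + x\<^sup>2)"
    proof (rule mult_right_mono)
      show "0 \<le> 1 - x + x\<^sup>2" using assms by (simp add: add_nonneg_nonneg)
    qed simp
    finally show ?thesis by (simp add: exp_minus divide_simps mult.commute)
  qed
  ultimately have "exp (- x) + exp x \<le> 2 * (1 + x\<^sup>2)" by simp
  also have "2 * (1 + x\<^sup>2) \<le> 2 * exp (x\<^sup>2)" by (intro mult_left_mono exp_ge_add_one_self) simp
  finally show ?thesis .
qed

lemma sum_signs_exp:
  fixes x :: real
  shows "(\<Sum>\<epsilon>\<in>signs L. exp (x * (\<Sum>y<L. \<epsilon> y))) = (exp (- x) + exp x) ^ L"
proof -
  have "(\<Sum>\<epsilon>\<in>signs L. exp (x * (\<Sum>y<L. \<epsilon> y))) = (\<Sum>\<epsilon>\<in>signs L. \<Prod>y<L. exp (x * \<epsilon> y))"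
    by (simp add: sum_distrib_left exp_sum)
  also have "\<dots> = (\<Prod>y<L. \<Sum>e\<in>{- 1, 1}. exp (x * e))"
    unfolding signs_def by (rule prod_sum_PiE[symmetric]) auto
  finally show ?thesis by simp
qed

text \<open>Moments from the moment generating function: for even \<open>q\<close> the power
  \<open>(x * z) ^ q\<close> is at most \<open>fact q\<close> times the sum of the exponentials of
  \<open>x * z\<close> and \<open>- x * z\<close>. The scale \<open>x\<close> stays free and is
  later taken near the inverse square root of \<open>L\<close>.\<close>

lemma sum_signs_pow_le:
  fixes x :: real
  assumes x: "0 < x" "x \<le> 1" and "even q"
  shows "(\<Sum>\<epsilon>\<in>signs L. (\<Sum>y<L. \<epsilon> y) ^ q) \<le> 2 * 2 ^ L * exp (L * x\<^sup>2) * fact q / x ^ q"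
proof -
  have "z ^ q \<le> fact q / x ^ q * (exp (x * z) + exp (- x * z))" for z
  proof -
    have "x ^ q * z ^ q = \<bar>x * z\<bar> ^ q" using \<open>even q\<close> by (simp add: power_even_abs power_mult_distrib)
    also have "\<dots> \<le> fact q * exp \<bar>x * z\<bar>" by (rule power_le_fact_exp) simp
    also have "\<dots> \<le> fact q * (exp (x * z) + exp (- x * z))"
      by (intro mult_left_mono) (auto simp: abs_if)
    finally show ?thesis using x by (simp add: field_simps)
  qed
  then have "(\<Sum>\<epsilon>\<in>signs L. (\<Sum>y<L. \<epsilon> y) ^ q) \<le>
      (\<Sum>\<epsilon>\<in>signs L. fact q / x ^ q * (exp (x * (\<Sum>y<L. \<epsilon> y)) + exp (- x * (\<Sum>y<L. \<epsilon> y))))"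
    by (intro sum_mono)
  also have "\<dots> = fact q / x ^ q * (2 * (exp (- x) + exp x) ^ L)"
    unfolding sum_distrib_left[symmetric] sum.distrib sum_signs_exp by (simp add: add.commute)
  also have "\<dots> \<le> fact q / x ^ q * (2 * (2 * exp (x\<^sup>2)) ^ L)"
    using x exp_sym_sum_le[of x] by (intro mult_left_mono power_mono) (auto intro: add_nonneg_nonneg)
  also have "\<dots> = 2 * 2 ^ L * exp (L * x\<^sup>2) * fact q / x ^ q"
    by (simp add: power_mult_distrib exp_of_nat_mult[symmetric] mult_ac)
  finally show ?thesis .
qed

subsection \<open>Measurement effects and trace norms\<close>

definition output_proj :: "nat \<Rightarrow> complex mat" where
  "output_proj N = kron proj1 (1\<^sub>m (2 ^ (N - 1)))"

lemma output_proj_carrier: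
  assumes "0 < N" shows "output_proj N \<in> carrier_mat (2 ^ N) (2 ^ N)"
proof -
  have "(2::nat) * 2 ^ (N - 1) = 2 ^ N" using assms by (simp flip: power_Suc)
  moreover have "output_proj N \<in> carrier_mat (2 * 2 ^ (N - 1)) (2 * 2 ^ (N - 1))"
    unfolding output_proj_def by (intro kron_carrier) (auto simp: proj1_def)
  ultimately show ?thesis by simp
qed

lemma adj_output_proj: "adj (output_proj N) = output_proj N"
proof -
  have "adj proj1 = proj1" by (rule eq_matI) (auto simp: proj1_def)
  then show ?thesis by (simp add: output_proj_def adj_kron)
qed

lemma output_proj_index:
  assumes "0 < N" "i < 2 ^ N" "j < 2 ^ N"
  shows "output_proj N $$ (i, j) = (if i = j \<and> i div 2 ^ (N - 1) = 1 then 1 else 0)"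
proof -
  have N: "(2::nat) * 2 ^ (N - 1) = 2 ^ N" using assms(1) by (simp flip: power_Suc)
  then have lt: "i < 2 * 2 ^ (N - 1)" "j < 2 * 2 ^ (N - 1)" using assms by auto
  have "i = j \<longleftrightarrow> i div 2 ^ (N - 1) = j div 2 ^ (N - 1) \<and> i mod 2 ^ (N - 1) = j mod 2 ^ (N - 1)"
    by (metis div_mult_mod_eq)
  then show ?thesis
    using lt div_mod_less[OF lt(1)] div_mod_less[OF lt(2)]
    by (auto simp: output_proj_def kron_index proj1_def)
qed

lemma contraction_output_proj:
  assumes N: "0 < N"
  shows "contraction (2 ^ N) (output_proj N)"
  unfolding contraction_def
proof (intro conjI ballI)
  note Pc = output_proj_carrier[OF N]
  show "output_proj N \<in> carrier_mat (2 ^ N) (2 ^ N)" by (rule Pc)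
  fix v :: "complex vec" assume v: "v \<in> carrier_vec (2 ^ N)"
  have "(output_proj N *\<^sub>v v) $ i = (if i div 2 ^ (N - 1) = 1 then v $ i else 0)" if i: "i < 2 ^ N" for i
  proof -
    have "(output_proj N *\<^sub>v v) $ i = (\<Sum>k<2 ^ N. output_proj N $$ (i, k) * v $ k)"
      by (rule mult_mat_vec_index_sum[OF Pc v i])
    also have "\<dots> = (\<Sum>k<2 ^ N. if k = i then (if i div 2 ^ (N - 1) = 1 then v $ i else 0) else 0)"
      using i by (intro sum.cong) (auto simp: output_proj_index[OF N])
    finally show ?thesis using i by simp
  qed
  then show "nsq (output_proj N *\<^sub>v v) \<le> nsq v"
    using Pc v unfolding nsq_def by (auto intro!: sum_mono)
qed

text \<open>The measurement operator of outcome 1 in the Heisenberg picture, pulled back through the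
  circuit to the input registers.\<close>

definition effect :: "nat \<Rightarrow> gate list \<Rightarrow> complex mat" where
  "effect N C = adj (circuit_mat N C) * (output_proj N * circuit_mat N C)"

lemma effect_properties:
  assumes "circuit_wf N C" "0 < N"
  shows "contraction (2 ^ N) (effect N C)" "adj (effect N C) = effect N C"
proof -
  let ?U = "circuit_mat N C" and ?P = "output_proj N"
  have U: "?U \<in> carrier_mat (2 ^ N) (2 ^ N)" "unitary ?U"
    using circuit_mat_unitary[OF assms(1)] by auto
  note U' = adj_carrier[OF U(1)] and P = output_proj_carrier[OF assms(2)]
  show "contraction (2 ^ N) (effect N C)"
    unfolding effect_def
    using U U' assms by (intro contraction_mult contraction_output_proj contraction_unitary unitary_adj)
  show "adj (effect N C) = effect N C"
    unfolding effect_def adj_mult[OF U' mult_carrier_mat[OF P U(1)]] adj_mult[OF P U(1)] adj_output_proj adj_adj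
    by (rule assoc_mult_mat[OF U' P U(1)])
qed

lemma trace_effect:
  assumes C: "circuit_wf N C" "0 < N" and \<sigma>: "\<sigma> \<in> carrier_mat (2 ^ N) (2 ^ N)"
  shows "mtrace (output_proj N * (circuit_mat N C * \<sigma> * adj (circuit_mat N C))) = mtrace (effect N C * \<sigma>)"
proof -
  let ?U = "circuit_mat N C" and ?P = "output_proj N"
  have U: "?U \<in> carrier_mat (2 ^ N) (2 ^ N)" using circuit_mat_unitary[OF C(1)] by auto
  note U' = adj_carrier[OF U] and P = output_proj_carrier[OF C(2)]
  have U\<sigma>: "?U * \<sigma> \<in> carrier_mat (2 ^ N) (2 ^ N)" using U \<sigma> by auto
  have PU: "?P * ?U \<in> carrier_mat (2 ^ N) (2 ^ N)" using U P by auto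
  have "?P * (?U * \<sigma> * adj ?U) = ?P * (?U * \<sigma>) * adj ?U"
    by (rule assoc_mult_mat[OF P U\<sigma> U', symmetric])
  then have "mtrace (?P * (?U * \<sigma> * adj ?U)) = mtrace (adj ?U * (?P * (?U * \<sigma>)))"
    using mtrace_comm[OF mult_carrier_mat[OF P U\<sigma>] U'] by simp
  also have "?P * (?U * \<sigma>) = ?P * ?U * \<sigma>"
    by (rule assoc_mult_mat[OF P U \<sigma>, symmetric])
  also have "adj ?U * (?P * ?U * \<sigma>) = effect N C * \<sigma>"
    unfolding effect_def by (rule assoc_mult_mat[OF U' PU \<sigma>, symmetric])
  finally show ?thesis .
qed

text \<open>The effect on the advice register once the challenge is the basis state \<open>x\<close> and the
  ancillas are zero.\<close>
definition advice_effect :: "gate list \<Rightarrow> nat \<Rightarrow> nat \<Rightarrow> nat \<Rightarrow> nat \<Rightarrow> complex mat" where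
  "advice_effect C m n a x = mat (2 ^ m) (2 ^ m)
     (\<lambda>(r, r'). effect (m + n + a) C $$ (r * (2 ^ n * 2 ^ a) + x * 2 ^ a, r' * (2 ^ n * 2 ^ a) + x * 2 ^ a))"

lemma advice_effect_properties:
  assumes C: "circuit_wf (m + n + a) C" and n: "0 < n" and x: "x < 2 ^ n"
  shows "contraction (2 ^ m) (advice_effect C m n a x)"
    and "adj (advice_effect C m n a x) = advice_effect C m n a x"
proof -
  let ?b = "(2::nat) ^ n * 2 ^ a" and ?N = "m + n + a"
  \<comment> \<open>Position of the basis state with advice \<open>r\<close>, challenge
    \<open>x\<close> and zero ancillas; the advice is the most significant register. The advice
    effect is the compression of the effect to these positions.\<close>
  let ?h = "\<lambda>r. r * ?b + x * 2 ^ a"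
  have N: "0 < ?N" using n by simp
  have N2: "2 ^ ?N = 2 ^ m * ?b" by (simp add: power_add)
  have xb: "x * 2 ^ a < ?b" using x by simp
  have h: "?h r < 2 ^ ?N" if "r < 2 ^ m" for r
    unfolding N2 by (rule mult_add_less[OF that xb])
  have inj: "inj_on ?h {..<2 ^ m}" by (auto simp: inj_on_def)
  have "contraction (2 ^ m) (mat (2 ^ m) (2 ^ m) (\<lambda>(r, r'). effect ?N C $$ (?h r, ?h r')))"
    using h by (intro contraction_submatrix[OF effect_properties(1)[OF C N] inj]) auto
  then show "contraction (2 ^ m) (advice_effect C m n a x)"
    by (simp add: advice_effect_def)
  note E = contraction_carrier[OF effect_properties(1)[OF C N]]
  show "adj (advice_effect C m n a x) = advice_effect C m n a x"
  proof (rule eq_matI)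
    fix i j assume "i < dim_row (advice_effect C m n a x)" "j < dim_col (advice_effect C m n a x)"
    then have ij: "i < 2 ^ m" "j < 2 ^ m" by (auto simp: advice_effect_def)
    have "adj (advice_effect C m n a x) $$ (i, j) = cnj (effect ?N C $$ (?h j, ?h i))"
      using ij by (simp add: advice_effect_def)
    also have "\<dots> = effect ?N C $$ (?h i, ?h j)"
      by (rule hermitian_index[OF effect_properties(2)[OF C N] E h[OF ij(1)] h[OF ij(2)], symmetric])
    finally show "adj (advice_effect C m n a x) $$ (i, j) = advice_effect C m n a x $$ (i, j)"
      using ij by (simp add: advice_effect_def)
  qed (auto simp: advice_effect_def)
qed

definition diag_state :: "nat \<Rightarrow> (nat \<Rightarrow> complex) \<Rightarrow> complex mat" where
  "diag_state n c = mat (2 ^ n) (2 ^ n) (\<lambda>(i, j). if i = j then c i else 0)"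

text \<open>The diagonal state forces equal challenge indices and the ancilla projector forces both
  ancilla indices to 0, so one index pair per \<open>x\<close> survives.\<close>

lemma sum_diag_ancilla:
  "(\<Sum>k<2 ^ n * 2 ^ a. \<Sum>k'<2 ^ n * 2 ^ a. F k k' * kron (diag_state n c) (ket0_proj a) $$ (k', k)) =
    (\<Sum>x<2 ^ n. c x * F (x * 2 ^ a) (x * 2 ^ a))"
proof -
  have e: "kron (diag_state n c) (ket0_proj a) $$ (x' * 2 ^ a + z', x * 2 ^ a + z) =
      (if x' = x then (if z' = 0 then (if z = 0 then c x else 0) else 0) else 0)"
    if "x < 2 ^ n" "x' < 2 ^ n" "z < 2 ^ a" "z' < 2 ^ a" for x x' z z'
    using that by (subst kron_index_split[of _ "2 ^ n" "2 ^ n" _ "2 ^ a" "2 ^ a"])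
      (auto simp: diag_state_def ket0_proj_def)
  have "(\<Sum>k<2 ^ n * 2 ^ a. \<Sum>k'<2 ^ n * 2 ^ a. F k k' * kron (diag_state n c) (ket0_proj a) $$ (k', k)) =
      (\<Sum>x<2 ^ n. \<Sum>z<2 ^ a. \<Sum>x'<2 ^ n. \<Sum>z'<2 ^ a.
        if z' = 0 then (if x' = x then (if z = 0 then c x * F (x * 2 ^ a + z) (x' * 2 ^ a + z') else 0) else 0) else 0)"
    unfolding sum_div_mod by (intro sum.cong refl) (auto simp: e)
  also have "\<dots> = (\<Sum>x<2 ^ n. c x * F (x * 2 ^ a) (x * 2 ^ a))"
    by (intro sum.cong refl) simp
  finally show ?thesis .
qed

text \<open>The trace is linear in the challenge, so a diagonal challenge can be treated one basis
  state at a time. What remains lives on the advice register alone.\<close>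

lemma accept_prob_diag:
  assumes C: "circuit_wf (m + n + a) C" and n: "0 < n" and \<rho>: "\<rho> \<in> carrier_mat (2 ^ m) (2 ^ m)"
  shows "accept_prob C m \<rho> n (diag_state n c) a =
    Re (\<Sum>x<2 ^ n. c x * mtrace (\<rho> * advice_effect C m n a x))"
proof -
  let ?N = "m + n + a" and ?b = "(2::nat) ^ n * 2 ^ a" and ?d = "2 ^ m :: nat"
  let ?K = "kron (diag_state n c) (ket0_proj a)" and ?M = "advice_effect C m n a"
  let ?E = "effect ?N C"
  have N: "0 < ?N" using n by simp
  have N2: "2 ^ ?N = ?d * ?b" by (simp add: power_add)
  have K: "?K \<in> carrier_mat ?b ?b"
    by (intro kron_carrier) (auto simp: diag_state_def ket0_proj_def)
  have \<sigma>: "kron \<rho> ?K \<in> carrier_mat (2 ^ ?N) (2 ^ ?N)"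
    unfolding N2 by (intro kron_carrier \<rho> K)
  note E = contraction_carrier[OF effect_properties(1)[OF C N]]
  have "mtrace (?E * kron \<rho> ?K) = (\<Sum>i<?d * ?b. \<Sum>j<?d * ?b. ?E $$ (i, j) * kron \<rho> ?K $$ (j, i))"
    unfolding mtrace_mult[OF E \<sigma>] N2 ..
  also have "\<dots> = (\<Sum>r<?d. \<Sum>k<?b. \<Sum>r'<?d. \<Sum>k'<?b.
      \<rho> $$ (r', r) * (?E $$ (r * ?b + k, r' * ?b + k') * ?K $$ (k', k)))"
    unfolding sum_div_mod[of _ ?d ?b]
    by (intro sum.cong refl, subst kron_index_split[OF \<rho> K]) auto
  also have "\<dots> = (\<Sum>r<?d. \<Sum>r'<?d. \<Sum>k<?b. \<Sum>k'<?b.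
      \<rho> $$ (r', r) * (?E $$ (r * ?b + k, r' * ?b + k') * ?K $$ (k', k)))"
    by (intro sum.cong refl sum.swap)
  also have "\<dots> = (\<Sum>r<?d. \<Sum>r'<?d. \<Sum>x<2 ^ n.
      \<rho> $$ (r', r) * (c x * ?E $$ (r * ?b + x * 2 ^ a, r' * ?b + x * 2 ^ a)))"
    unfolding sum_distrib_left[symmetric] sum_diag_ancilla ..
  also have "\<dots> = (\<Sum>r<?d. \<Sum>r'<?d. \<Sum>x<2 ^ n. c x * (?M x $$ (r, r') * \<rho> $$ (r', r)))"
    by (intro sum.cong refl) (simp add: advice_effect_def)
  also have "\<dots> = (\<Sum>r<?d. \<Sum>x<2 ^ n. \<Sum>r'<?d. c x * (?M x $$ (r, r') * \<rho> $$ (r', r)))"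
    by (intro sum.cong[OF refl] sum.swap)
  also have "\<dots> = (\<Sum>x<2 ^ n. \<Sum>r<?d. \<Sum>r'<?d. c x * (?M x $$ (r, r') * \<rho> $$ (r', r)))"
    by (rule sum.swap)
  also have "\<dots> = (\<Sum>x<2 ^ n. c x * mtrace (\<rho> * ?M x))"
  proof (intro sum.cong refl)
    fix x
    have M: "?M x \<in> carrier_mat ?d ?d" by (simp add: advice_effect_def)
    show "(\<Sum>r<?d. \<Sum>r'<?d. c x * (?M x $$ (r, r') * \<rho> $$ (r', r))) = c x * mtrace (\<rho> * ?M x)"
      unfolding mtrace_comm[OF \<rho> M] mtrace_mult[OF M \<rho>] sum_distrib_left ..
  qed
  finally show ?thesis
    using trace_effect[OF C N \<sigma>] by (simp add: accept_prob_def output_proj_def Let_def)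
qed

section \<open>Trace norms of triangular matrices\<close>

lemma prod_linear_nonzero: "(\<Prod>a\<leftarrow>xs. [:- a, 1:]) \<noteq> (0 :: complex poly)"
  by (auto simp: prod_list_zero_iff)

text \<open>Summing over any finite superset \<open>X\<close> of the roots lets the induction pass
  to the tail, whose root set may be smaller; non-roots contribute order 0.\<close>

lemma order_prod_linear:
  assumes "set xs \<subseteq> X" "finite X"
  shows "(\<Sum>z\<in>X. real (order z (\<Prod>a\<leftarrow>xs. [:- a, 1:])) * f z) = (\<Sum>a\<leftarrow>xs. f (a :: complex))"
  using assms(1)
proof (induction xs)
  case (Cons b xs)
  have b: "order z [:- b, 1:] = (if z = b then 1 else 0)" for z
    using order_power_n_n[of b 1] by (auto intro: order_0I)
  have nz: "[:- b, 1:] * (\<Prod>a\<leftarrow>xs. [:- a, 1:]) \<noteq> 0"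
    using prod_linear_nonzero[of "b # xs"] by simp
  have "(\<Sum>z\<in>X. real (order z (\<Prod>a\<leftarrow>b # xs. [:- a, 1:])) * f z) =
      (\<Sum>z\<in>X. (if z = b then f z else 0) + real (order z (\<Prod>a\<leftarrow>xs. [:- a, 1:])) * f z)"
    using order_mult[OF nz] by (intro sum.cong refl) (auto simp: b algebra_simps)
  also have "\<dots> = f b + (\<Sum>a\<leftarrow>xs. f a)"
    using Cons assms(2) by (simp add: sum.distrib)
  finally show ?case by simp
qed (simp add: order_1_eq_0)

lemma trace_norm_upper_triangular:
  assumes A: "A \<in> carrier_mat n n" and ut: "upper_triangular A"
  shows "trace_norm_herm A = (\<Sum>i<n. cmod (A $$ (i, i)))"
proof -
  let ?xs = "diag_mat A" and ?p = "\<Prod>a\<leftarrow>diag_mat A. [:- a, 1:]"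
  have p: "char_poly A = ?p" by (rule char_poly_upper_triangular[OF A ut])
  have "{z. poly ?p z = 0} = set ?xs"
    by (auto simp: poly_prod_list prod_list_zero_iff)
  then have "trace_norm_herm A = (\<Sum>a\<leftarrow>?xs. cmod a)"
    unfolding trace_norm_herm_def p by (simp only: order_prod_linear[OF subset_refl finite_set])
  also have "\<dots> = (\<Sum>i<n. cmod (A $$ (i, i)))"
    using A by (simp add: diag_mat_def interv_sum_list_conv_sum_set_nat atLeast0LessThan comp_def)
  finally show ?thesis .
qed

subsection \<open>Signs that fool every small circuit\<close>

text \<open>The size \<open>2 ^ (l div 12)\<close> is superpolynomial. This serves both to dominate
  the resources of every adversary and to make the inverse of that size negligible.\<close>

lemma eventually_poly_le_exp:
  fixes c k :: nat
  shows "eventually (\<lambda>l. c * l ^ k + c \<le> 2 ^ (l div 12)) sequentially"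
proof -
  \<comment> \<open>Comes from the term of degree \<open>Suc k\<close> of the exponential series at
    \<open>J * ln 2\<close>, giving \<open>J ^ Suc k \<le> K * 2 ^ j\<close>. The spare factor
    \<open>J\<close> eventually exceeds the constant \<open>B\<close>.\<close>
  define K :: real where "K = fact (Suc k) * 2 / ln 2 ^ Suc k"
  define B where "B = real c * (12 ^ k + 1) * K"
  have K: "0 < K" by (simp add: K_def)
  have "eventually (\<lambda>l. nat \<lceil>12 * B\<rceil> \<le> l) sequentially" by (rule eventually_ge_at_top)
  then show ?thesis
  proof eventually_elim
    case (elim l)
    define j where "j = l div 12"
    define J where "J = real (Suc j)"
    have J: "1 \<le> J" "real l \<le> 12 * J" by (auto simp: J_def j_def)
    then have "B \<le> J" using elim by linarith
    have "(J * ln 2) ^ Suc k \<le> fact (Suc k) * exp (J * ln 2)"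
      using J by (intro power_le_fact_exp) auto
    also have "exp (J * ln 2) = 2 * 2 ^ j"
      unfolding J_def exp_of_nat_mult by simp
    finally have JK: "J ^ Suc k \<le> K * 2 ^ j"
      by (simp add: K_def power_mult_distrib field_simps)
    have "(real c * real l ^ k + real c) * K \<le> (real c * (12 * J) ^ k + real c * J ^ k) * K"
      using J K mult_left_mono[OF one_le_power[OF J(1), of k], of "real c"] by (intro mult_right_mono add_mono mult_left_mono power_mono) auto
    also have "\<dots> = B * J ^ k" by (simp add: B_def power_mult_distrib algebra_simps)
    also have "\<dots> \<le> J * J ^ k" using \<open>B \<le> J\<close> J by (intro mult_right_mono) auto
    also have "\<dots> \<le> K * 2 ^ j" using JK by simp
    finally have "real c * real l ^ k + real c \<le> 2 ^ j" using K by (simp add: mult.commute)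
    then have "real (c * l ^ k + c) \<le> real (2 ^ j)" by simp
    then show ?case by (simp only: of_nat_le_iff j_def)
  qed
qed

lemma trace_even_power_nonneg:
  assumes X: "X \<in> carrier_mat d d" "adj X = X"
  shows "0 \<le> Re (mtrace (X ^\<^sub>m (2 ^ Suc j)))"
proof -
  let ?Y = "X ^\<^sub>m (2 ^ j)"
  have "?Y \<in> carrier_mat d d" "adj ?Y = ?Y"
    using X pow_carrier_mat adj_pow_mat by blast+
  then have "0 \<le> Re (mtrace (?Y * ?Y))"
    by (simp add: trace_square_hermitian sum_nonneg del: index_mult_mat)
  then show ?thesis
    using pow_mat_add[OF X(1), of "2 ^ j" "2 ^ j"] by (simp add: mult_2)
qed

text \<open>Markov's inequality for the \<open>q\<close>-th moment. The existential over
  \<open>\<rho>\<close> lies inside \<open>Bad\<close>, so the continuum of advice states costs no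
  union bound, only the factor \<open>4 ^ m\<close>; the average trace contributes another
  \<open>2 ^ m\<close>.\<close>

lemma card_bad_signs:
  fixes \<tau> x :: real
  assumes D: "\<And>y. y < L \<Longrightarrow> contraction (2 ^ m) (D y)" "\<And>y. y < L \<Longrightarrow> adj (D y) = D y"
    and q: "q = 2 ^ Suc j" and \<tau>: "0 < \<tau>" and x: "0 < x" "x \<le> 1"
  defines "Bad \<equiv> {\<epsilon> \<in> signs L. \<exists>\<rho>. density m \<rho> \<and> \<tau> < \<bar>Re (mtrace (\<rho> * signed_sum (2 ^ m) L D \<epsilon>))\<bar>}"
  shows "card Bad * (x * \<tau>) ^ q \<le> 8 ^ m * (2 * 2 ^ L * exp (L * x\<^sup>2) * fact q)"
proof -
  let ?S = "signed_sum (2 ^ m) L D"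
  let ?T = "\<lambda>\<epsilon>. Re (mtrace (?S \<epsilon> ^\<^sub>m q))"
  have S: "?S \<epsilon> \<in> carrier_mat (2 ^ m) (2 ^ m)" "adj (?S \<epsilon>) = ?S \<epsilon>" for \<epsilon>
    using D by (auto intro!: adj_signed_sum contraction_carrier)
  have "card Bad * \<tau> ^ q = (\<Sum>\<epsilon>\<in>Bad. \<tau> ^ q)" by simp
  also have "\<dots> \<le> (\<Sum>\<epsilon>\<in>Bad. 4 ^ m * ?T \<epsilon>)"
  proof (rule sum_mono)
    fix \<epsilon> assume "\<epsilon> \<in> Bad"
    then obtain \<rho> where \<rho>: "density m \<rho>" "\<tau> < \<bar>Re (mtrace (\<rho> * ?S \<epsilon>))\<bar>" by (auto simp: Bad_def)
    have "\<tau> ^ q \<le> \<bar>Re (mtrace (\<rho> * ?S \<epsilon>))\<bar> ^ q" using \<rho> \<tau> by (intro power_mono) auto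
    also have "\<dots> \<le> 4 ^ m * ?T \<epsilon>" unfolding q by (rule density_moment_trace[OF \<rho>(1) S])
    finally show "\<tau> ^ q \<le> 4 ^ m * ?T \<epsilon>" .
  qed
  \<comment> \<open>Even powers of a Hermitian matrix have non-negative trace, so the sum may be
    extended to all signs.\<close>
  also have "\<dots> \<le> (\<Sum>\<epsilon>\<in>signs L. 4 ^ m * ?T \<epsilon>)"
    using trace_even_power_nonneg[OF S] unfolding Bad_def q by (intro sum_mono2) auto
  also have "\<dots> = 4 ^ m * (\<Sum>\<epsilon>\<in>signs L. ?T \<epsilon>)" by (simp add: sum_distrib_left)
  also have "\<dots> \<le> 4 ^ m * (2 ^ m * (\<Sum>\<epsilon>\<in>signs L. (\<Sum>y<L. \<epsilon> y) ^ q))"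
    using sum_signs_trace_pow[of L "2 ^ m" D q] D(1) by (intro mult_left_mono) auto
  also have "\<dots> = 8 ^ m * (\<Sum>\<epsilon>\<in>signs L. (\<Sum>y<L. \<epsilon> y) ^ q)"
    by (simp flip: power_mult_distrib mult.assoc)
  also have "\<dots> \<le> 8 ^ m * (2 * 2 ^ L * exp (L * x\<^sup>2) * fact q / x ^ q)"
    using x by (intro mult_left_mono sum_signs_pow_le) (auto simp: q)
  finally have "card Bad * \<tau> ^ q * x ^ q \<le> 8 ^ m * (2 * 2 ^ L * exp (L * x\<^sup>2) * fact q / x ^ q) * x ^ q"
    using x by (intro mult_right_mono) auto
  then show ?thesis using x by (simp add: power_mult_distrib mult_ac)
qed

text \<open>Choice of parameters. The scale \<open>x\<close> makes \<open>2 ^ l * x\<^sup>2\<close>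
  at most 2, and \<open>2 * q \<le> x * \<tau>\<close>; since \<open>fact q \<le> q ^ q\<close>, the
  fraction of bad signs gains a factor \<open>2 ^ q\<close> in the denominator.\<close>

lemma card_bad_signs_exp:
  fixes l :: nat
  defines "i \<equiv> l div 12"
  assumes D: "\<And>y. y < 2 ^ l \<Longrightarrow> contraction (2 ^ m) (D y)" "\<And>y. y < 2 ^ l \<Longrightarrow> adj (D y) = D y"
    and i: "2 \<le> i"
  defines "Bad \<equiv> {\<epsilon> \<in> signs (2 ^ l). \<exists>\<rho>. density m \<rho> \<and>
    2 ^ l / (2 * 2 ^ i) < \<bar>Re (mtrace (\<rho> * signed_sum (2 ^ m) (2 ^ l) D \<epsilon>))\<bar>}"
  shows "card Bad * 2 ^ 2 ^ (2 * i + 4) \<le> 32 * 8 ^ m * 2 ^ 2 ^ l"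
proof -
  define q :: nat where "q = 2 ^ (2 * i + 4)"
  define h where "h = l div 2"
  define x :: real where "x = 1 / 2 ^ h"
  \<comment> \<open>After the normalisation \<open>2 / 2 ^ l\<close> this threshold is an advantage
    of \<open>1 / 2 ^ i\<close>.\<close>
  define \<tau> :: real where "\<tau> = 2 ^ l / (2 * 2 ^ i)"
  have x: "0 < x" "x \<le> 1" and \<tau>: "0 < \<tau>" by (auto simp: x_def \<tau>_def)
  have q: "q = 2 ^ Suc (2 * i + 3)" by (simp add: q_def)
  have qpos: "0 < q" by (simp add: q_def)
  have *: "card Bad * (x * \<tau>) ^ q \<le> 8 ^ m * (2 * 2 ^ (2 ^ l) * exp ((2 ^ l :: nat) * x\<^sup>2) * fact q)"
    unfolding Bad_def \<tau>_def[symmetric] by (rule card_bad_signs[OF D q \<tau> x])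
  have "l \<le> Suc (2 * h)" by (auto simp: h_def)
  then have "(2::real) ^ l \<le> 2 ^ Suc (2 * h)" by (intro power_increasing) auto
  also have "\<dots> = 2 * (2 ^ h)\<^sup>2" by (simp add: power_mult[symmetric] mult.commute)
  finally have "(2 ^ l :: nat) * x\<^sup>2 \<le> 2"
    by (simp add: x_def field_simps)
  then have "exp ((2 ^ l :: nat) * x\<^sup>2) \<le> exp 2" by simp
  also have "exp 2 = exp (1::real) * exp 1" by (simp flip: exp_add)
  also have "\<dots> \<le> 3 * 3" using exp_le by (intro mult_mono) auto
  finally have e: "exp ((2 ^ l :: nat) * x\<^sup>2) \<le> 16" by simp
  \<comment> \<open>The divisor 12 is chosen for this: \<open>3 * i + 6 \<le> 6 * i\<close> because
    \<open>2 \<le> i\<close>, and \<open>6 * i\<close> is at most half of \<open>l\<close>, while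
    \<open>h\<close> takes at most the other half.\<close>
  have "(2 * i + 5) + h + 1 + i \<le> l" using i unfolding h_def i_def by linarith
  then have "(2::real) ^ ((2 * i + 5) + h + 1 + i) \<le> 2 ^ l" by (intro power_increasing) auto
  moreover have "(2::real) ^ ((2 * i + 5) + h + 1 + i) = 2 * real q * (2 ^ h * (2 * 2 ^ i))"
  proof -
    have "2 * real q = 2 ^ (2 * i + 5)" by (simp add: q_def power_add)
    then show ?thesis by (simp only: power_add power_one_right mult_ac)
  qed
  moreover have "x * \<tau> = 2 ^ l / (2 ^ h * (2 * 2 ^ i))" by (simp add: x_def \<tau>_def)
  ultimately have "2 * real q \<le> x * \<tau>"
    by (simp only: pos_le_divide_eq zero_less_power zero_less_mult_iff zero_less_numeral simp_thms)
  then have "(2 * real q) ^ q \<le> (x * \<tau>) ^ q" by (intro power_mono) auto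
  then have "card Bad * (2 * real q) ^ q \<le> card Bad * (x * \<tau>) ^ q" by (intro mult_left_mono) auto
  also note *
  also have "8 ^ m * (2 * 2 ^ (2 ^ l) * exp ((2 ^ l :: nat) * x\<^sup>2) * fact q) \<le>
      8 ^ m * (2 * 2 ^ (2 ^ l) * 16 * real q ^ q)"
    using e fact_le_power[of q] by (intro mult_left_mono mult_mono) auto
  finally have "(card Bad * 2 ^ q) * real q ^ q \<le> (32 * 8 ^ m * 2 ^ 2 ^ l) * real q ^ q"
    by (simp add: power_mult_distrib mult_ac)
  then have "real (card Bad * 2 ^ q) \<le> 32 * 8 ^ m * 2 ^ 2 ^ l"
    using qpos by (simp add: mult_le_cancel_right)
  also have "\<dots> = real (32 * 8 ^ m * 2 ^ 2 ^ l)" by simp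
  finally show ?thesis unfolding q_def of_nat_le_iff .
qed

text \<open>The observable that the sign of pair \<open>y\<close> multiplies in the advantage;
  halving keeps it a contraction.\<close>

definition pair_effect :: "gate list \<Rightarrow> nat \<Rightarrow> nat \<Rightarrow> nat \<Rightarrow> nat \<Rightarrow> complex mat" where
  "pair_effect C m l a y = mat (2 ^ m) (2 ^ m)
     (\<lambda>ij. (advice_effect C m (Suc l) a (y * 2) $$ ij - advice_effect C m (Suc l) a (y * 2 + 1) $$ ij) / 2)"

lemma pair_effect_properties:
  assumes C: "circuit_wf (m + Suc l + a) C" and y: "y < 2 ^ l"
  shows "contraction (2 ^ m) (pair_effect C m l a y)" "adj (pair_effect C m l a y) = pair_effect C m l a y"
proof -
  have y2: "y * 2 < 2 ^ Suc l" "y * 2 + 1 < 2 ^ Suc l" using y by auto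
  note p = advice_effect_properties[OF C zero_less_Suc]
  show "contraction (2 ^ m) (pair_effect C m l a y)"
    unfolding pair_effect_def by (intro contraction_half_diff p y2)
  show "adj (pair_effect C m l a y) = pair_effect C m l a y"
  proof (rule eq_matI)
    fix i j assume "i < dim_row (pair_effect C m l a y)" "j < dim_col (pair_effect C m l a y)"
    then have ij: "i < 2 ^ m" "j < 2 ^ m" by (auto simp: pair_effect_def)
    have "cnj (advice_effect C m (Suc l) a z $$ (j, i)) = advice_effect C m (Suc l) a z $$ (i, j)"
      if "z < 2 ^ Suc l" for z
      by (rule hermitian_index[OF p(2)[OF that] contraction_carrier[OF p(1)[OF that]] ij, symmetric])
    from this[OF y2(1)] this[OF y2(2)]
    show "adj (pair_effect C m l a y) $$ (i, j) = pair_effect C m l a y $$ (i, j)"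
      using ij by (simp add: pair_effect_def)
  qed (auto simp: pair_effect_def)
qed

text \<open>One superpolynomial bound limits advice qubits, ancillas and gates alike. The threshold
  corresponds to a distinguishing advantage of \<open>1 / 2 ^ (l div 12)\<close>.\<close>

definition fooling :: "nat \<Rightarrow> (nat \<Rightarrow> real) \<Rightarrow> bool" where
  "fooling l \<epsilon> \<longleftrightarrow> (\<forall>m a C \<rho>. m \<le> 2 ^ (l div 12) \<and> a \<le> 2 ^ (l div 12) \<and> length C \<le> 2 ^ (l div 12) \<and>
     circuit_wf (m + Suc l + a) C \<and> density m \<rho> \<longrightarrow>
     \<bar>Re (mtrace (\<rho> * signed_sum (2 ^ m) (2 ^ l) (pair_effect C m l a) \<epsilon>))\<bar> \<le> 2 ^ l / (2 * 2 ^ (l div 12)))"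

lemma gate_wf_mono: "gate_wf n g \<Longrightarrow> n \<le> k \<Longrightarrow> gate_wf k g"
  by (cases g) auto

text \<open>Union bound over the finitely many triples of advice length, ancilla count and circuit:
  if no signs worked, the bad sets would cover \<open>signs (2 ^ l)\<close>, but their sizes add up
  to less.\<close>

lemma fooling_signs_exist:
  assumes l: "Suc l \<le> 2 ^ (l div 12)" "2 \<le> l div 12"
  shows "\<exists>\<epsilon>\<in>signs (2 ^ l). fooling l \<epsilon>"
proof (rule ccontr)
  assume none: "\<not> ?thesis"
  define i where "i = l div 12"
  define s :: nat where "s = 2 ^ i"
  define q :: nat where "q = 2 ^ (2 * i + 4)"
  \<comment> \<open>The largest register width that can occur. A circuit well formed on fewer qubits
    is also well formed on \<open>K\<close>, so the single set \<open>CS\<close> serves all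
    \<open>m\<close> and \<open>a\<close>.\<close>
  define K where "K = s + Suc l + s"
  define CS where "CS = {C. circuit_wf K C \<and> length C \<le> s}"
  define I where "I = {..s} \<times> {..s} \<times> CS"
  \<comment> \<open>A circuit in \<open>CS\<close> can be ill formed for a given \<open>m\<close>
    and \<open>a\<close>; such a triple gets the empty set.\<close>
  define Bad where "Bad = (\<lambda>(m, a, C). {\<epsilon> \<in> signs (2 ^ l). circuit_wf (m + Suc l + a) C \<and>
    (\<exists>\<rho>. density m \<rho> \<and> 2 ^ l / (2 * 2 ^ i) <
      \<bar>Re (mtrace (\<rho> * signed_sum (2 ^ m) (2 ^ l) (pair_effect C m l a) \<epsilon>))\<bar>)})"
  have finI: "finite I" by (simp add: I_def CS_def finite_bounded_circuits)
  have s4: "4 \<le> s"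
  proof -
    have "(2::nat) ^ 2 \<le> 2 ^ i" using l unfolding i_def by (intro power_increasing) auto
    then show ?thesis by (simp add: s_def)
  qed
  have cover: "signs (2 ^ l) \<subseteq> (\<Union>p\<in>I. Bad p)"
  proof
    fix \<epsilon> assume \<epsilon>: "\<epsilon> \<in> signs (2 ^ l)"
    with none have "\<not> fooling l \<epsilon>" by blast
    then obtain m a C \<rho> where p: "m \<le> s" "a \<le> s" "length C \<le> s" "circuit_wf (m + Suc l + a) C" "density m \<rho>"
      "2 ^ l / (2 * 2 ^ i) < \<bar>Re (mtrace (\<rho> * signed_sum (2 ^ m) (2 ^ l) (pair_effect C m l a) \<epsilon>))\<bar>"
      unfolding fooling_def s_def i_def by (auto simp: not_le)
    have "circuit_wf K C"
      using p(1,2,4) unfolding circuit_wf_def K_def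
      by (intro ballI) (rule gate_wf_mono[of "m + Suc l + a"], auto)
    then have "(m, a, C) \<in> I" using p by (simp add: I_def CS_def)
    moreover have "\<epsilon> \<in> Bad (m, a, C)" using p \<epsilon> by (auto simp: Bad_def)
    ultimately show "\<epsilon> \<in> (\<Union>p\<in>I. Bad p)" by blast
  qed
  have bad: "card (Bad p) * 2 ^ q \<le> 32 * 8 ^ s * 2 ^ 2 ^ l" if "p \<in> I" for p
  proof -
    obtain m a C where p: "p = (m, a, C)" by (cases p)
    show ?thesis
    proof (cases "circuit_wf (m + Suc l + a) C")
      case True
      then have "card (Bad p) * 2 ^ q \<le> 32 * 8 ^ m * 2 ^ 2 ^ l"
        using card_bad_signs_exp[OF pair_effect_properties[OF True], of l] l
        unfolding p Bad_def q_def i_def by simp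
      also have "\<dots> \<le> 32 * 8 ^ s * 2 ^ 2 ^ l"
        using that by (intro mult_mono power_increasing) (auto simp: p I_def)
      finally show ?thesis .
    qed (simp add: p Bad_def)
  qed
  have "2 ^ 2 ^ l * 2 ^ q = card (signs (2 ^ l)) * 2 ^ q" by (simp add: card_signs)
  also have "\<dots> \<le> card (\<Union>p\<in>I. Bad p) * 2 ^ q"
    using cover finI by (intro mult_right_mono card_mono) (auto simp: Bad_def)
  also have "\<dots> \<le> (\<Sum>p\<in>I. card (Bad p)) * 2 ^ q"
    by (intro mult_right_mono card_UN_le finI) simp
  also have "\<dots> = (\<Sum>p\<in>I. card (Bad p) * 2 ^ q)" by (rule sum_distrib_right)
  also have "\<dots> \<le> (\<Sum>p\<in>I. 32 * 8 ^ s * 2 ^ 2 ^ l)" by (rule sum_mono[OF bad])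
  also have "\<dots> = card I * (32 * 8 ^ s * 2 ^ 2 ^ l)" by simp
  finally have "(2::nat) ^ 2 ^ l * 2 ^ q \<le> 2 ^ 2 ^ l * (card I * (32 * 8 ^ s))" by (simp only: mult_ac)
  then have q_le: "(2::nat) ^ q \<le> card I * (32 * 8 ^ s)" by simp
  have "card I \<le> (s + 1) * ((s + 1) * ((s + 1) * 4 ^ (K * s)))"
    unfolding I_def CS_def card_cartesian_product
    by (intro mult_mono card_bounded_circuits) auto
  also have "\<dots> \<le> 2 ^ s * (2 ^ s * (2 ^ s * 4 ^ (3 * s * s)))"
  proof -
    have "s + 1 \<le> 2 ^ s" using Suc_leI[OF less_exp[of s]] by simp
    moreover have "Suc l \<le> s" using l(1) by (simp add: s_def i_def)
    then have "K \<le> 3 * s" by (simp add: K_def)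
    then have "(4::nat) ^ (K * s) \<le> 4 ^ (3 * s * s)"
      by (intro power_increasing mult_le_mono1) auto
    ultimately show ?thesis by (intro mult_le_mono)
  qed
  finally have "card I * (32 * 8 ^ s) \<le> 2 ^ s * (2 ^ s * (2 ^ s * 4 ^ (3 * s * s))) * (32 * 8 ^ s)"
    by (rule mult_le_mono1)
  also have "2 ^ s * (2 ^ s * (2 ^ s * 4 ^ (3 * s * s))) * (32 * 8 ^ s) = (2::nat) ^ (6 * s + 6 * s * s + 5)"
  proof -
    have pows: "(4::nat) ^ (3 * s * s) = 2 ^ (2 * (3 * s * s))" "(8::nat) ^ s = 2 ^ (3 * s)" "(32::nat) = 2 ^ 5"
      by (simp_all add: power_mult)
    show ?thesis
      unfolding pows power_add[symmetric] by (rule arg_cong[where f = "power 2"]) simp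
  qed
  finally have "(2::nat) ^ q \<le> 2 ^ (6 * s + 6 * s * s + 5)" using q_le by (rule order_trans[rotated])
  then have "q \<le> 6 * s + 6 * s * s + 5" by (rule power_le_imp_le_exp[rotated]) simp
  \<comment> \<open>The offset 4 in the exponent of \<open>q\<close> supplies the 16, which beats
    the \<open>6 * s * s\<close> from the circuit count once \<open>4 \<le> s\<close>.\<close>
  moreover have "q = 16 * (s * s)" unfolding q_def s_def power_add mult_2 by simp
  moreover have "4 * s \<le> s * s" "4 * 4 \<le> s * s" using s4 by (intro mult_mono; simp)+
  ultimately show False by simp
qed

subsection \<open>The challenge states\<close>

text \<open>Affine in \<open>\<epsilon>\<close> so that the acceptance probabilities are too; for signs the value is \<open>0\<close> or \<open>1 / 2 ^ l\<close>.\<close>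
definition challenge_weight :: "nat \<Rightarrow> (nat \<Rightarrow> real) \<Rightarrow> bool \<Rightarrow> nat \<Rightarrow> real" where
  "challenge_weight l \<epsilon> b x = (1 + (- 1) ^ x * (if b then - 1 else 1) * \<epsilon> (x div 2)) / 2 ^ Suc l"

definition challenge :: "nat \<Rightarrow> (nat \<Rightarrow> real) \<Rightarrow> bool \<Rightarrow> complex mat" where
  "challenge l \<epsilon> b = diag_state (Suc l) (\<lambda>x. complex_of_real (challenge_weight l \<epsilon> b x))"

lemma sum_pairs: "(\<Sum>x<2 ^ Suc l. f x) = (\<Sum>y<2 ^ l. f (y * 2) + f (y * 2 + 1 :: nat))"
proof -
  have "(2::nat) ^ Suc l = 2 ^ l * 2" by simp
  then show ?thesis by (simp only: sum_div_mod) (simp add: numeral_2_eq_2)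
qed

lemma half_less_power: "x < 2 ^ Suc l \<Longrightarrow> x div 2 < (2 :: nat) ^ l"
  by (simp add: less_mult_imp_div_less mult.commute)

lemma signs_cases: "\<epsilon> \<in> signs L \<Longrightarrow> y < L \<Longrightarrow> \<epsilon> y = 1 \<or> \<epsilon> y = - 1"
  by (auto simp: signs_def PiE_iff)

lemma challenge_weight_nonneg:
  assumes "\<epsilon> \<in> signs (2 ^ l)" "x < 2 ^ Suc l"
  shows "0 \<le> challenge_weight l \<epsilon> b x"
  using signs_cases[OF assms(1) half_less_power[OF assms(2)]]
  by (auto simp: challenge_weight_def minus_one_power_iff)

lemma density_challenge:
  assumes \<epsilon>: "\<epsilon> \<in> signs (2 ^ l)"
  shows "density (Suc l) (challenge l \<epsilon> b)"
  unfolding density_def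
proof (intro conjI ballI)
  let ?d = "2 ^ Suc l :: nat" and ?w = "challenge_weight l \<epsilon> b"
  show c: "challenge l \<epsilon> b \<in> carrier_mat ?d ?d"
    by (simp add: challenge_def diag_state_def)
  show "adj (challenge l \<epsilon> b) = challenge l \<epsilon> b"
    by (rule eq_matI) (auto simp: challenge_def diag_state_def)
  have "mtrace (challenge l \<epsilon> b) = (\<Sum>x<?d. complex_of_real (?w x))"
    by (simp add: mtrace_def challenge_def diag_state_def)
  also have "\<dots> = complex_of_real (\<Sum>x<?d. ?w x)" by simp
  also have "(\<Sum>x<?d. ?w x) = (\<Sum>y<(2 :: nat) ^ l. 1 / 2 ^ l)"
    unfolding sum_pairs by (intro sum.cong refl) (simp add: challenge_weight_def field_simps)
  finally show "mtrace (challenge l \<epsilon> b) = 1" by simp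
  fix v :: "complex vec" assume v: "v \<in> carrier_vec ?d"
  have "conjugate v \<bullet> (challenge l \<epsilon> b *\<^sub>v v) =
      (\<Sum>i<?d. \<Sum>j<?d. cnj (v $ i) * challenge l \<epsilon> b $$ (i, j) * v $ j)"
    using quad_form_sum[OF c, of "\<lambda>i. v $ i"] v by (metis carrier_vecD eq_vecI index_vec dim_vec)
  also have "\<dots> = (\<Sum>i<?d. \<Sum>j<?d. if j = i then ?w i * (v $ i * cnj (v $ i)) else 0)"
    by (intro sum.cong refl) (auto simp: challenge_def diag_state_def)
  also have "\<dots> = complex_of_real (\<Sum>i<?d. ?w i * (cmod (v $ i))\<^sup>2)"
    by (simp add: complex_norm_square del: of_real_power power_Suc)
  finally show "0 \<le> Re (conjugate v \<bullet> (challenge l \<epsilon> b *\<^sub>v v))"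
    using challenge_weight_nonneg[OF \<epsilon>] by (auto intro!: sum_nonneg mult_nonneg_nonneg)
qed

text \<open>The difference is diagonal with \<open>2 ^ Suc l\<close> entries of modulus
  \<open>1 / 2 ^ l\<close>, hence has trace norm 2.\<close>

lemma TD_challenge:
  assumes \<epsilon>: "\<epsilon> \<in> signs (2 ^ l)"
  shows "TD (challenge l \<epsilon> False) (challenge l \<epsilon> True) = 1"
proof -
  let ?d = "2 ^ Suc l :: nat"
  let ?A = "challenge l \<epsilon> False - challenge l \<epsilon> True"
  have A: "?A \<in> carrier_mat ?d ?d" "upper_triangular ?A"
    by (auto simp: challenge_def diag_state_def)
  have "cmod (?A $$ (i, i)) = 1 / 2 ^ l" if i: "i < ?d" for i
  proof -
    have "?A $$ (i, i) = complex_of_real ((- 1) ^ i * \<epsilon> (i div 2) / 2 ^ l)"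
      using i by (simp add: challenge_def diag_state_def challenge_weight_def field_simps)
    moreover have "\<bar>\<epsilon> (i div 2)\<bar> = 1" using signs_cases[OF \<epsilon> half_less_power[OF i]] by auto
    ultimately show ?thesis by (simp only: norm_of_real) (simp add: abs_mult power_abs)
  qed
  then show ?thesis
    unfolding TD_def trace_norm_upper_triangular[OF A] by simp
qed

text \<open>On the pair \<open>y * 2\<close>, \<open>y * 2 + 1\<close> the two weight functions
  differ by \<open>\<epsilon> y / 2 ^ l\<close> and its negative. The factor 2 undoes the halving in
  \<open>pair_effect\<close>.\<close>

lemma accept_prob_challenge_diff:
  assumes C: "circuit_wf (m + Suc l + a) C" and \<rho>: "\<rho> \<in> carrier_mat (2 ^ m) (2 ^ m)"
  shows "accept_prob C m \<rho> (Suc l) (challenge l \<epsilon> False) a - accept_prob C m \<rho> (Suc l) (challenge l \<epsilon> True) a =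
    2 / 2 ^ l * Re (mtrace (\<rho> * signed_sum (2 ^ m) (2 ^ l) (pair_effect C m l a) \<epsilon>))"
proof -
  let ?M = "advice_effect C m (Suc l) a" and ?d = "2 ^ m :: nat" and ?D = "pair_effect C m l a"
  let ?S = "signed_sum ?d (2 ^ l) ?D \<epsilon>"
  have M: "?M x \<in> carrier_mat ?d ?d" for x by (simp add: advice_effect_def)
  have D: "complex_of_real (\<epsilon> y) * (mtrace (\<rho> * ?M (y * 2)) - mtrace (\<rho> * ?M (y * 2 + 1))) =
      2 * (\<Sum>i<?d. \<Sum>k<?d. \<rho> $$ (i, k) * (complex_of_real (\<epsilon> y) * ?D y $$ (k, i)))" for y
    unfolding mtrace_mult[OF \<rho> M] sum_subtractf[symmetric] sum_distrib_left
    by (intro sum.cong refl) (simp add: pair_effect_def field_simps)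
  have "mtrace (\<rho> * ?S) = (\<Sum>i<?d. \<Sum>k<?d. \<Sum>y<2 ^ l. \<rho> $$ (i, k) * (complex_of_real (\<epsilon> y) * ?D y $$ (k, i)))"
    unfolding mtrace_mult[OF \<rho> signed_sum_carrier]
    by (intro sum.cong refl) (simp add: signed_sum_def sum_distrib_left)
  also have "\<dots> = (\<Sum>i<?d. \<Sum>y<2 ^ l. \<Sum>k<?d. \<rho> $$ (i, k) * (complex_of_real (\<epsilon> y) * ?D y $$ (k, i)))"
    by (intro sum.cong[OF refl] sum.swap)
  also have "\<dots> = (\<Sum>y<2 ^ l. \<Sum>i<?d. \<Sum>k<?d. \<rho> $$ (i, k) * (complex_of_real (\<epsilon> y) * ?D y $$ (k, i)))"
    by (rule sum.swap)
  finally have S: "2 * mtrace (\<rho> * ?S) =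
      (\<Sum>y<2 ^ l. complex_of_real (\<epsilon> y) * (mtrace (\<rho> * ?M (y * 2)) - mtrace (\<rho> * ?M (y * 2 + 1))))"
    by (simp only: D sum_distrib_left)
  let ?w = "challenge_weight l \<epsilon>"
  have w: "?w False x - ?w True x = (- 1) ^ x * \<epsilon> (x div 2) / 2 ^ l" for x
    by (simp add: challenge_weight_def field_simps)
  have "(\<Sum>x<2 ^ Suc l. complex_of_real (?w False x) * mtrace (\<rho> * ?M x)) -
      (\<Sum>x<2 ^ Suc l. complex_of_real (?w True x) * mtrace (\<rho> * ?M x)) =
      (\<Sum>x<2 ^ Suc l. complex_of_real (?w False x - ?w True x) * mtrace (\<rho> * ?M x))"
    by (simp add: sum_subtractf left_diff_distrib del: power_Suc)
  also have "\<dots> = (\<Sum>y<2 ^ l. complex_of_real (\<epsilon> y) * (mtrace (\<rho> * ?M (y * 2)) - mtrace (\<rho> * ?M (y * 2 + 1))) / 2 ^ l)"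
    unfolding sum_pairs w by (intro sum.cong refl) (simp add: field_simps)
  also have "\<dots> = 2 * mtrace (\<rho> * ?S) / 2 ^ l"
    unfolding S sum_divide_distrib ..
  finally have e: "(\<Sum>x<2 ^ Suc l. complex_of_real (?w False x) * mtrace (\<rho> * ?M x)) -
      (\<Sum>x<2 ^ Suc l. complex_of_real (?w True x) * mtrace (\<rho> * ?M x)) = complex_of_real (2 / 2 ^ l) * mtrace (\<rho> * ?S)"
    by simp
  show ?thesis
    unfolding challenge_def accept_prob_diag[OF C zero_less_Suc \<rho>] minus_complex.sel(1)[symmetric] e
    by simp
qed

theorem theorem4p3:
  shows "\<exists>(n :: nat \<Rightarrow> nat) (\<xi> :: nat \<Rightarrow> bool \<Rightarrow> complex mat).
     poly_bounded n \<and>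
     (\<forall>l b. density (n l) (\<xi> l b)) \<and>
     negl (\<lambda>l. 1 - TD (\<xi> l False) (\<xi> l True)) \<and>
     (\<forall>(p :: nat \<Rightarrow> nat) (C :: nat \<Rightarrow> gate list) (m :: nat \<Rightarrow> nat) (a :: nat \<Rightarrow> nat)
        (\<rho> :: nat \<Rightarrow> complex mat).
        poly_bounded p \<and>
        (\<forall>l. circuit_wf (m l + n l + a l) (C l) \<and> length (C l) \<le> p l \<and>
             m l \<le> p l \<and> a l \<le> p l \<and> density (m l) (\<rho> l)) \<longrightarrow>
        negl (\<lambda>l. accept_prob (C l) (m l) (\<rho> l) (n l) (\<xi> l False) (a l)
                 - accept_prob (C l) (m l) (\<rho> l) (n l) (\<xi> l True) (a l)))"
proof -
  \<comment> \<open>For small \<open>l\<close> any signs do: the states must be densities for every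
    \<open>l\<close>, but indistinguishability is asymptotic.\<close>
  have "\<exists>\<epsilon>. \<epsilon> \<in> signs (2 ^ l) \<and> (Suc l \<le> 2 ^ (l div 12) \<and> 2 \<le> l div 12 \<longrightarrow> fooling l \<epsilon>)" for l
  proof (cases "Suc l \<le> 2 ^ (l div 12) \<and> 2 \<le> l div 12")
    case False
    moreover have "signs (2 ^ l) \<noteq> {}" by (auto simp: signs_def PiE_eq_empty_iff)
    ultimately show ?thesis by blast
  qed (use fooling_signs_exist in blast)
  then obtain \<epsilon> where \<epsilon>: "\<And>l. \<epsilon> l \<in> signs (2 ^ l)"
    and fool: "\<And>l. Suc l \<le> 2 ^ (l div 12) \<Longrightarrow> 2 \<le> l div 12 \<Longrightarrow> fooling l (\<epsilon> l)"
    by metis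
  show ?thesis
  proof (intro exI[of _ Suc] exI[of _ "\<lambda>l. challenge l (\<epsilon> l)"] conjI allI impI; (elim conjE)?)
    have "Suc l \<le> 1 * l ^ 1 + 1" for l by simp
    then show "poly_bounded Suc" unfolding poly_bounded_def by blast
    show "density (Suc l) (challenge l (\<epsilon> l) b)" for l b by (rule density_challenge[OF \<epsilon>])
    show "negl (\<lambda>l. 1 - TD (challenge l (\<epsilon> l) False) (challenge l (\<epsilon> l) True))"
      by (simp add: TD_challenge[OF \<epsilon>] negl_def)
    fix p m a :: "nat \<Rightarrow> nat" and C :: "nat \<Rightarrow> gate list" and \<rho> :: "nat \<Rightarrow> complex mat"
    assume "poly_bounded p" and adv: "\<forall>l. circuit_wf (m l + Suc l + a l) (C l) \<and> length (C l) \<le> p l \<and>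
      m l \<le> p l \<and> a l \<le> p l \<and> density (m l) (\<rho> l)"
    then obtain c k where p: "\<And>l. p l \<le> c * l ^ k + c" by (auto simp: poly_bounded_def)
    let ?diff = "\<lambda>l. accept_prob (C l) (m l) (\<rho> l) (Suc l) (challenge l (\<epsilon> l) False) (a l) -
      accept_prob (C l) (m l) (\<rho> l) (Suc l) (challenge l (\<epsilon> l) True) (a l)"
    show "negl ?diff"
      unfolding negl_def
    proof
      fix e :: nat
      \<comment> \<open>In order: the adversary fits the size bound, the challenge fits it as
        \<open>fool\<close> requires, the advantage is at most \<open>1 / l ^ e\<close>, and
        \<open>2 \<le> l div 12\<close>.\<close>
      have "eventually (\<lambda>l. c * l ^ k + c \<le> 2 ^ (l div 12)) sequentially"
        "eventually (\<lambda>l. 1 * l ^ 1 + 1 \<le> (2::nat) ^ (l div 12)) sequentially"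
        "eventually (\<lambda>l. 1 * l ^ e + 1 \<le> (2::nat) ^ (l div 12)) sequentially"
        "eventually (\<lambda>l::nat. 24 \<le> l) sequentially"
        by (rule eventually_poly_le_exp eventually_ge_at_top)+
      then show "eventually (\<lambda>l. \<bar>?diff l\<bar> \<le> 1 / real l ^ e) sequentially"
      proof eventually_elim
        case (elim l)
        let ?s = "(2::nat) ^ (l div 12)"
        let ?t = "\<bar>Re (mtrace (\<rho> l * signed_sum (2 ^ m l) (2 ^ l) (pair_effect (C l) (m l) l (a l)) (\<epsilon> l)))\<bar>"
        have "2 \<le> l div 12" using elim by simp
        then have "fooling l (\<epsilon> l)" using elim by (intro fool) auto
        moreover have "p l \<le> ?s" using p[of l] elim by linarith
        ultimately have t: "?t \<le> 2 ^ l / (2 * 2 ^ (l div 12))"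
          using adv unfolding fooling_def by (meson order_trans)
        have "\<bar>?diff l\<bar> = 2 / 2 ^ l * ?t"
          using adv by (subst accept_prob_challenge_diff) (auto simp: abs_mult intro: density_carrier)
        also have "\<dots> \<le> 2 / 2 ^ l * (2 ^ l / (2 * 2 ^ (l div 12)))"
          using t by (intro mult_left_mono) auto
        also have "\<dots> = 1 / real ?s" by simp
        also have "\<dots> \<le> 1 / real (l ^ e)"
        proof (rule divide_left_mono)
          show "real (l ^ e) \<le> real ?s" using elim by (simp only: of_nat_le_iff)
        qed (use elim in auto)
        finally show ?case by simp
      qed
    qed
  qed
qed

end
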